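(* Let $\lambda$ be a non-trivial translation-invariant probability measure on the space of entire functions. Then, for $\lambda$-almost every function $f$, $$\liminf_{R\to\infty}\frac{\log\log M_f(R)}{\log^2 R}>0 .$$
   Context: The space of entire functions on $\mathbb{C}$ carries the topology of locally uniform convergence and its Borel $\sigma$-algebra. The group $\mathbb{C}$ acts on it by translations, $(T_wf)(z)=f(z+w)$ for $w\in\mathbb{C}$. A probability measure $\lambda$ on this space is translation-invariant if it is invariant under $T_w$ for every $w\in\mathbb{C}$. It is non-trivial if the set of constant functions has $\lambda$-measure zero. $M_f(R)=\sup_{|z|<R}|f(z)|$. *)

theory Defs
  imports "HOL-Complex_Analysis.Complex_Analysis" "HOL-Probability.Probability"
begin

definition entire_functions :: "(complex \<Rightarrow> complex) set" where
  "entire_functions = {f. f holomorphic_on UNIV}"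

(* On the locally compact plane, locally uniform convergence is uniform convergence on compact
   sets; the sets {g. \<forall>z\<in>K. dist (f z) (g z) < e} form a neighbourhood base at f. *)
definition entire_open :: "(complex \<Rightarrow> complex) set \<Rightarrow> bool" where
  "entire_open U \<longleftrightarrow> U \<subseteq> entire_functions \<and>
     (\<forall>f\<in>U. \<exists>K e. compact K \<and> e > 0 \<and>
        (\<forall>g\<in>entire_functions. (\<forall>z\<in>K. dist (f z) (g z) < e) \<longrightarrow> g \<in> U))"

lemma istopology_entire_open: "istopology entire_open"
  unfolding istopology_def
proof (intro conjI allI impI)
  fix S T assume S: "entire_open S" and T: "entire_open T"
  show "entire_open (S \<inter> T)"
    unfolding entire_open_def
  proof (intro conjI ballI)
    show "S \<inter> T \<subseteq> entire_functions" using S by (auto simp: entire_open_def)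
    fix f assume f: "f \<in> S \<inter> T"
    obtain K e where 1: "compact K" "e > 0"
      "\<And>g. g \<in> entire_functions \<Longrightarrow> \<forall>z\<in>K. dist (f z) (g z) < e \<Longrightarrow> g \<in> S"
      using S f unfolding entire_open_def by blast
    obtain L d where 2: "compact L" "d > 0"
      "\<And>g. g \<in> entire_functions \<Longrightarrow> \<forall>z\<in>L. dist (f z) (g z) < d \<Longrightarrow> g \<in> T"
      using T f unfolding entire_open_def by blast
    show "\<exists>K e. compact K \<and> e > 0 \<and>
        (\<forall>g\<in>entire_functions. (\<forall>z\<in>K. dist (f z) (g z) < e) \<longrightarrow> g \<in> S \<inter> T)"
      by (rule exI[of _ "K \<union> L"], rule exI[of _ "min e d"]) (use 1 2 in auto)
  qed
next
  fix \<K> assume *: "\<forall>S\<in>\<K>. entire_open S"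
  show "entire_open (\<Union>\<K>)"
    unfolding entire_open_def
  proof (intro conjI ballI)
    show "\<Union>\<K> \<subseteq> entire_functions" using * by (auto simp: entire_open_def)
    fix f assume "f \<in> \<Union>\<K>"
    then obtain S where S: "S \<in> \<K>" "f \<in> S" by blast
    from * S(1) have "entire_open S" ..
    with S(2) obtain K e where "compact K" "e > 0"
      "\<forall>g\<in>entire_functions. (\<forall>z\<in>K. dist (f z) (g z) < e) \<longrightarrow> g \<in> S"
      unfolding entire_open_def by blast
    then show "\<exists>K e. compact K \<and> e > 0 \<and>
        (\<forall>g\<in>entire_functions. (\<forall>z\<in>K. dist (f z) (g z) < e) \<longrightarrow> g \<in> \<Union>\<K>)"
      using S(1) by (intro exI[of _ K] exI[of _ e]) auto
  qed
qed

definition entire_topology :: "(complex \<Rightarrow> complex) topology" where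
  "entire_topology = topology entire_open"

lemma openin_entire_topology: "openin entire_topology = entire_open"
  by (simp add: entire_topology_def istopology_entire_open topology_inverse')

lemma topspace_entire_topology: "topspace entire_topology = entire_functions"
proof
  show "topspace entire_topology \<subseteq> entire_functions"
    by (auto simp: topspace_def openin_entire_topology entire_open_def)
  have "entire_open entire_functions"
    unfolding entire_open_def
    by (intro conjI ballI subset_refl exI[of _ "{}"] exI[of _ "1::real"]) auto
  then show "entire_functions \<subseteq> topspace entire_topology"
    by (metis openin_entire_topology openin_subset)
qed

definition entire_borel :: "(complex \<Rightarrow> complex) measure" where
  "entire_borel = sigma entire_functions {U. openin entire_topology U}"

lemma open_subset_Pow_entire: "{U. openin entire_topology U} \<subseteq> Pow entire_functions"
  using openin_subset topspace_entire_topology by blast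

lemma space_entire_borel: "space entire_borel = entire_functions"
  by (simp add: entire_borel_def open_subset_Pow_entire)

lemma sets_entire_borel:
  "sets entire_borel = sigma_sets entire_functions {U. openin entire_topology U}"
  by (simp add: entire_borel_def open_subset_Pow_entire)

definition translate :: "complex \<Rightarrow> (complex \<Rightarrow> complex) \<Rightarrow> complex \<Rightarrow> complex" where
  "translate w f = (\<lambda>z. f (z + w))"

lemma translate_entire: "f \<in> entire_functions \<Longrightarrow> translate w f \<in> entire_functions"
  using holomorphic_on_compose_gen[of "\<lambda>z. z + w" UNIV f UNIV]
  by (simp add: entire_functions_def translate_def comp_def holomorphic_intros)

lemma measurable_translate: "translate w \<in> entire_borel \<rightarrow>\<^sub>M entire_borel"
proof (subst (2) entire_borel_def, rule measurable_measure_of)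
  show "{U. openin entire_topology U} \<subseteq> Pow entire_functions"
    by (rule open_subset_Pow_entire)
  show "translate w \<in> space entire_borel \<rightarrow> entire_functions"
    by (auto simp: space_entire_borel translate_entire)
  fix U assume "U \<in> {U. openin entire_topology U}"
  then have U: "entire_open U" by (simp add: openin_entire_topology)
  have "entire_open (translate w -` U \<inter> entire_functions)"
    unfolding entire_open_def
  proof (intro conjI ballI)
    fix f assume f: "f \<in> translate w -` U \<inter> entire_functions"
    then have "translate w f \<in> U" by simp
    then obtain K e where K: "compact K" "e > 0"
      "\<And>g. g \<in> entire_functions \<Longrightarrow> \<forall>z\<in>K. dist (translate w f z) (g z) < e \<Longrightarrow> g \<in> U"
      using U unfolding entire_open_def by blast
    have "compact ((\<lambda>z. z + w) ` K)"
      using K(1) by (intro compact_continuous_image continuous_intros)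
    moreover have "g \<in> translate w -` U \<inter> entire_functions"
      if "g \<in> entire_functions" "\<forall>z\<in>(\<lambda>z. z + w) ` K. dist (f z) (g z) < e" for g
      using that K(3)[OF translate_entire[OF that(1)]] by (auto simp: translate_def)
    ultimately show "\<exists>K e. compact K \<and> e > 0 \<and> (\<forall>g\<in>entire_functions.
        (\<forall>z\<in>K. dist (f z) (g z) < e) \<longrightarrow> g \<in> translate w -` U \<inter> entire_functions)"
      by (intro exI[of _ "(\<lambda>z. z + w) ` K"] exI[of _ e]) (simp add: K(2))
  qed auto
  then show "translate w -` U \<inter> space entire_borel \<in> sets entire_borel"
    unfolding sets_entire_borel space_entire_borel
    by (intro sigma_sets.Basic) (simp add: openin_entire_topology)
qed

definition translation_invariant :: "(complex \<Rightarrow> complex) measure \<Rightarrow> bool" where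
  "translation_invariant \<mu> \<longleftrightarrow> (\<forall>w. distr \<mu> \<mu> (translate w) = \<mu>)"

definition constant_functions :: "(complex \<Rightarrow> complex) set" where
  "constant_functions = {f. \<exists>c. f = (\<lambda>_. c)}"

lemma constant_functions_sets: "constant_functions \<in> sets entire_borel"
proof -
  have "entire_open (entire_functions - constant_functions)"
    unfolding entire_open_def
  proof (intro conjI ballI)
    fix f assume f: "f \<in> entire_functions - constant_functions"
    have "\<exists>a. f a \<noteq> f 0"
    proof (rule ccontr)
      assume "\<nexists>a. f a \<noteq> f 0"
      then have "f = (\<lambda>_. f 0)" by (intro ext) simp
      then have "f \<in> constant_functions" unfolding constant_functions_def mem_Collect_eq by (rule exI)
      with f show False by simp
    qed
    then obtain a where a: "f a \<noteq> f 0" ..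
    define e where "e = dist (f a) (f 0) / 2"
    have "e > 0" using a by (simp add: e_def)
    moreover have "g \<notin> constant_functions"
      if "\<forall>z\<in>{a, 0}. dist (f z) (g z) < e" for g
    proof
      assume "g \<in> constant_functions"
      then have "g a = g 0" by (auto simp: constant_functions_def)
      with that have "dist (f a) (f 0) < 2 * e"
        using dist_triangle_less_add[of "f a" "g a" e "f 0" e] by simp
      then show False by (simp add: e_def)
    qed
    moreover have "compact {a, 0}" by simp
    ultimately show "\<exists>K e. compact K \<and> e > 0 \<and> (\<forall>g\<in>entire_functions.
        (\<forall>z\<in>K. dist (f z) (g z) < e) \<longrightarrow> g \<in> entire_functions - constant_functions)"
      by (intro exI[of _ "{a, 0}"] exI[of _ e]) simp
  qed auto
  then have "entire_functions - constant_functions \<in> sets entire_borel"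
    unfolding sets_entire_borel by (intro sigma_sets.Basic) (simp add: openin_entire_topology)
  then have "space entire_borel - (entire_functions - constant_functions) \<in> sets entire_borel"
    by (rule sets.compl_sets)
  moreover have "space entire_borel - (entire_functions - constant_functions) = constant_functions"
    by (auto simp: space_entire_borel constant_functions_def entire_functions_def)
  ultimately show ?thesis by simp
qed

definition max_modulus :: "(complex \<Rightarrow> complex) \<Rightarrow> real \<Rightarrow> real" where
  "max_modulus f R = (SUP z\<in>ball 0 R. norm (f z))"

end

theory Submission
  imports Defs
begin

text \<open>
  Fix a threshold \<open>C\<close> and put \<open>u = max 0 (ln \<bar>f / C\<bar>)\<close>. If \<open>C\<close> is large, then the set
  \<open>{\<bar>f\<bar> > C}\<close>, here coarsened to the set \<open>B\<close> of unit lattice squares that it meets, has small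
  density. A nonnegative subharmonic function that vanishes on half of a disc is at the centre at most half of
  its maximum over the disc. So the maximum of \<open>u\<close> over a disc around an origin doubles whenever
  the radius grows by a step \<open>w\<close>, unless the maximum point lies in a square of size about \<open>w\<close> in
  which \<open>B\<close> has positive density. The inequality is proved without integration: the maximum
  principle is applied to the product of the functions \<open>\<zeta> \<mapsto> f (z + p * \<zeta>)\<close> over a square
  array of points \<open>p\<close> (\<open>submean_power\<close>, \<open>log_growth_double\<close>).

  Between the radii \<open>2^k\<close> and \<open>2^(k + 1)\<close> there is room for \<open>2^l\<close> steps of length
  \<open>2^(k - l)\<close>. If most of these steps double \<open>u\<close>, the maximum gains a factor of at least
  \<open>2^(2^(l - 1))\<close>. In the block of levels \<open>k\<close> between \<open>2^l\<close> and \<open>2^(l + 1)\<close> the number of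
  steps per level is thus comparable to \<open>k\<close>, and if a fixed proportion of the levels is good, the
  double logarithm of the maximum modulus gains a multiple of \<open>4^l\<close>, that is, of the square of
  the logarithm of the radius (\<open>slow_imp_bad_block\<close>, \<open>iterated_log_growth\<close>).

  It remains to see that an origin is rarely bad. The dyadic cells in which \<open>B\<close> has
  density at least \<open>1/288\<close> cover at most \<open>288\<close> times the area of \<open>B\<close>, and every point of them
  is assigned to the largest such cell. A maximal cell of size \<open>2^j\<close> can spoil about
  \<open>2^j / w\<close> steps at a level \<open>k\<close>, for about \<open>4^k\<close> origins. A level is lost only if about \<open>2^l\<close>
  steps are spoiled, and a block only if about \<open>2^l\<close> levels are lost. With \<open>w = 2^(k - l)\<close>, a sum
  over \<open>j < k \<le> j + l\<close>, geometric in \<open>k\<close>, shows that the cell spoils a block of levels for at most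
  a constant times \<open>4^j\<close> origins, which is its own area. Each cell size belongs
  to one block only, so the bounds add up over all blocks:
  the origins with some bad block have density at most a constant times that of \<open>B\<close>
  (\<open>card_bad_origins\<close>). By translation invariance this density bound is a bound for the
  probability that the origin \<open>0\<close> is bad (\<open>slow_event_bound\<close>), uniformly in the number of blocks,
  and the bound tends to \<open>0\<close> as \<open>C\<close> grows. Liouville's theorem starts the growth.
\<close>

section \<open>Lattice points and dyadic cells\<close>

definition lattice_point :: "int \<times> int \<Rightarrow> complex" where
  "lattice_point p = Complex (of_int (fst p)) (of_int (snd p))"

definition cell :: "nat \<Rightarrow> int \<times> int \<Rightarrow> int \<times> int" where
  "cell j p = (fst p div 2^j, snd p div 2^j)"

definition cell_set :: "nat \<Rightarrow> int \<times> int \<Rightarrow> (int \<times> int) set" where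
  "cell_set j p = {q. cell j q = cell j p}"

lemma div_fiber: "m > 0 \<Longrightarrow> {x::int. x div m = c} = {c * m..<c * m + m}"
proof (intro set_eqI, unfold mem_Collect_eq atLeastLessThan_iff)
  fix x assume m: "m > (0::int)"
  have "x = x div m * m + x mod m" by (rule div_mult_mod_eq[symmetric])
  moreover have "0 \<le> x mod m" "x mod m < m" using m by auto
  moreover have "x div m = c" if "c * m \<le> x \<and> x < c * m + m"
    using m that by (intro int_div_pos_eq[of _ _ _ "x - c * m"]) (auto simp: algebra_simps)
  ultimately show "x div m = c \<longleftrightarrow> c * m \<le> x \<and> x < c * m + m" by (smt (verit))
qed

lemma cell_set_eq:
  "cell_set j p = {fst p div 2^j * 2^j..<fst p div 2^j * 2^j + 2^j} \<times>
                  {snd p div 2^j * 2^j..<snd p div 2^j * 2^j + 2^j}"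
proof -
  have "cell_set j p = {x. x div 2^j = fst p div 2^j} \<times> {x. x div 2^j = snd p div 2^j}"
    by (auto simp: cell_set_def cell_def)
  then show ?thesis by (simp only: div_fiber[OF zero_less_power[OF zero_less_numeral]])
qed

lemma finite_cell_set: "finite (cell_set j p)"
  by (simp add: cell_set_eq)

lemma card_cell_set: "card (cell_set j p) = 4^j"
  by (simp add: cell_set_eq card_cartesian_product nat_power_eq flip: power_mult_distrib)

lemma self_in_cell_set: "p \<in> cell_set j p"
  by (simp add: cell_set_def)

lemma cell_set_sym: "q \<in> cell_set j p \<longleftrightarrow> p \<in> cell_set j q"
  by (auto simp: cell_set_def)

lemma cell_set_coarser:
  assumes "q \<in> cell_set j p" "j \<le> i"
  shows "cell_set i q = cell_set i p"
proof -
  have "x div 2^i = x div 2^j div 2^(i - j)" for x :: int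
    using assms(2) by (simp add: zdiv_zmult2_eq[symmetric] flip: power_add)
  then show ?thesis using assms(1) by (simp add: cell_set_def cell_def)
qed

lemma cell_set_dist:
  assumes "q \<in> cell_set j p"
  shows "cmod (lattice_point q - lattice_point p) \<le> 2 * 2^j"
proof -
  have "\<bar>fst q - fst p\<bar> \<le> 2^j" "\<bar>snd q - snd p\<bar> \<le> 2^j"
    using assms self_in_cell_set[of p j] unfolding cell_set_eq by (auto simp: mem_Times_iff)
  then have "\<bar>real_of_int (fst q - fst p)\<bar> \<le> real_of_int (2^j)" "\<bar>real_of_int (snd q - snd p)\<bar> \<le> real_of_int (2^j)"
    by linarith+
  then show ?thesis
    using cmod_le[of "lattice_point q - lattice_point p"] by (simp add: lattice_point_def)
qed

lemma lattice_ball_subset: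
  "{q. cmod (lattice_point q - lattice_point p) \<le> real r} \<subseteq>
     {fst p - int r..fst p + int r} \<times> {snd p - int r..snd p + int r}"
proof
  fix q assume "q \<in> {q. cmod (lattice_point q - lattice_point p) \<le> real r}"
  then have "\<bar>real_of_int (fst q - fst p)\<bar> \<le> real r" "\<bar>real_of_int (snd q - snd p)\<bar> \<le> real r"
    using abs_Re_le_cmod[of "lattice_point q - lattice_point p"]
      abs_Im_le_cmod[of "lattice_point q - lattice_point p"] by (auto simp: lattice_point_def)
  then have "\<bar>fst q - fst p\<bar> \<le> int r" "\<bar>snd q - snd p\<bar> \<le> int r" by linarith+
  then show "q \<in> {fst p - int r..fst p + int r} \<times> {snd p - int r..snd p + int r}"
    by (auto simp: mem_Times_iff)
qed

lemma finite_lattice_ball: "finite {q. cmod (lattice_point q - lattice_point p) \<le> real r}"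
  by (rule finite_subset[OF lattice_ball_subset]) auto

lemma card_lattice_ball:
  "card {q. cmod (lattice_point q - lattice_point p) \<le> real r} \<le> (2 * r + 1)^2"
  using card_mono[OF _ lattice_ball_subset[of p r]]
  by (simp add: card_cartesian_product power2_eq_square nat_add_distrib nat_mult_distrib)

section \<open>Heavy cells\<close>

text \<open>
  The factor \<open>288 = 9 * 32\<close>: a disc of radius \<open>2^j\<close> is covered by nine cells of level \<open>j\<close>, and
  the doubling of the growth across the disc tolerates \<open>4^j / 32\<close> large squares in it.
\<close>

definition heavy :: "(int \<times> int) set \<Rightarrow> nat \<Rightarrow> int \<times> int \<Rightarrow> bool" where
  "heavy B j p \<longleftrightarrow> 4^j \<le> 288 * card (B \<inter> cell_set j p)"

text \<open>
  The bound \<open>K\<close> on the levels makes the largest heavy cell around a point well defined; all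
  estimates are uniform in \<open>K\<close>.
\<close>

definition marked :: "(int \<times> int) set \<Rightarrow> nat \<Rightarrow> (int \<times> int) set" where
  "marked B K = {p. \<exists>j\<le>K. heavy B j p}"

definition top_level :: "(int \<times> int) set \<Rightarrow> nat \<Rightarrow> int \<times> int \<Rightarrow> nat" where
  "top_level B K p = (GREATEST j. j \<le> K \<and> heavy B j p)"

lemma top_level:
  assumes "p \<in> marked B K"
  shows "top_level B K p \<le> K" "heavy B (top_level B K p) p"
proof -
  have "top_level B K p \<le> K \<and> heavy B (top_level B K p) p"
    unfolding top_level_def by (rule GreatestI_ex_nat[of _ K]) (use assms in \<open>auto simp: marked_def\<close>)
  then show "top_level B K p \<le> K" "heavy B (top_level B K p) p" by auto
qed

lemma top_level_ge: "j \<le> K \<Longrightarrow> heavy B j p \<Longrightarrow> j \<le> top_level B K p"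
  unfolding top_level_def by (rule Greatest_le_nat[of _ _ K]) auto

text \<open>
  All points of a maximal heavy cell have this cell as their maximal heavy cell. Consequently such a
  cell may be represented by its points, each with weight \<open>1 / 4^j\<close>, and the double counts below
  run over points rather than over cells.
\<close>

lemma top_level_cell:
  assumes p: "p \<in> marked B K" and q: "q \<in> cell_set (top_level B K p) p"
  shows "q \<in> marked B K" "top_level B K q = top_level B K p"
proof -
  let ?j = "top_level B K p"
  have h: "heavy B i q \<longleftrightarrow> heavy B i p" if "?j \<le> i" for i
    using cell_set_coarser[OF q that] by (simp add: heavy_def)
  show m: "q \<in> marked B K" using top_level[OF p] h by (auto simp: marked_def)
  have "?j \<le> top_level B K q" using top_level[OF p] h by (intro top_level_ge) auto
  moreover from this have "top_level B K q \<le> ?j"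
    using top_level[OF m] h by (intro top_level_ge) auto
  ultimately show "top_level B K q = ?j" by simp
qed

lemma finite_marked:
  assumes "finite B" shows "finite (marked B K)"
proof (rule finite_subset)
  show "marked B K \<subseteq> (\<Union>j\<le>K. \<Union>b\<in>B. cell_set j b)"
  proof
    fix p assume "p \<in> marked B K"
    then obtain j where j: "j \<le> K" "heavy B j p" by (auto simp: marked_def)
    then have "B \<inter> cell_set j p \<noteq> {}" by (auto simp: heavy_def)
    then show "p \<in> (\<Union>j\<le>K. \<Union>b\<in>B. cell_set j b)" using j cell_set_sym by blast
  qed
  show "finite (\<Union>j\<le>K. \<Union>b\<in>B. cell_set j b)" using assms finite_cell_set by auto
qed

lemma sum_top_level_cell:
  assumes "p \<in> marked B K"
  shows "(\<Sum>q\<in>cell_set (top_level B K p) p. 1 / 4^top_level B K q) = (1::real)"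
proof -
  have "(\<Sum>q\<in>cell_set (top_level B K p) p. 1 / 4^top_level B K q)
      = (\<Sum>q\<in>cell_set (top_level B K p) p. (1::real) / 4^top_level B K p)"
    by (intro sum.cong) (use top_level_cell[OF assms] in auto)
  then show ?thesis by (simp add: card_cell_set)
qed

text \<open>
  The maximal heavy cells are disjoint, and \<open>B\<close> fills at least \<open>1/288\<close> of each.
\<close>

lemma card_marked:
  assumes fin: "finite B"
  shows "real (card (marked B K)) \<le> 288 * real (card B)"
proof -
  let ?H = "marked B K" and ?t = "top_level B K"
  note finH = finite_marked[OF fin, of K]
  have "real (card ?H) = (\<Sum>p\<in>?H. 1)" by simp
  also have "\<dots> \<le> (\<Sum>p\<in>?H. \<Sum>q\<in>B. if q \<in> cell_set (?t p) p then 288 / 4^?t p else 0)"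
  proof (rule sum_mono)
    fix p assume p: "p \<in> ?H"
    have "real (4^?t p) \<le> real (288 * card (B \<inter> cell_set (?t p) p))"
      using top_level(2)[OF p] unfolding heavy_def by (simp only: of_nat_le_iff)
    then have "1 \<le> 288 / 4^?t p * real (card (B \<inter> cell_set (?t p) p))"
      by (simp add: field_simps)
    also have "\<dots> = (\<Sum>q\<in>B. if q \<in> cell_set (?t p) p then 288 / 4^?t p else 0)"
      using fin by (simp add: sum.If_cases Int_def)
    finally show "1 \<le> (\<Sum>q\<in>B. if q \<in> cell_set (?t p) p then 288 / 4^?t p else (0::real))" .
  qed
  also have "\<dots> = (\<Sum>q\<in>B. \<Sum>p\<in>?H. if q \<in> cell_set (?t p) p then 288 / 4^?t p else 0)"
    by (rule sum.swap)
  also have "\<dots> \<le> (\<Sum>q\<in>B. 288)"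
  proof (rule sum_mono)
    fix q
    have "(\<Sum>p\<in>?H. if q \<in> cell_set (?t p) p then 288 / 4^?t p else (0::real))
        = (\<Sum>p\<in>{p\<in>?H. q \<in> cell_set (?t p) p}. 288 * (1 / 4^?t p))"
      using finH by (simp add: sum.inter_filter)
    also have "\<dots> \<le> 288"
    proof (cases "{p\<in>?H. q \<in> cell_set (?t p) p} = {}")
      case False
      then obtain p0 where p0: "p0 \<in> ?H" "q \<in> cell_set (?t p0) p0" by auto
      have q: "q \<in> ?H" using top_level_cell(1)[OF p0] .
      have "{p\<in>?H. q \<in> cell_set (?t p) p} \<subseteq> cell_set (?t q) q"
        using top_level_cell(2) cell_set_sym by fastforce
      then have "(\<Sum>p\<in>{p\<in>?H. q \<in> cell_set (?t p) p}. 1 / 4^?t p) \<le> (\<Sum>p\<in>cell_set (?t q) q. (1::real) / 4^?t p)"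
        by (intro sum_mono2 finite_cell_set) auto
      then show ?thesis unfolding sum_top_level_cell[OF q] sum_distrib_left[symmetric] by simp
    next
      case True
      then show ?thesis unfolding True by simp
    qed
    finally show "(\<Sum>p\<in>?H. if q \<in> cell_set (?t p) p then 288 / 4^?t p else (0::real)) \<le> 288" .
  qed
  finally show ?thesis by simp
qed

section \<open>Counting the bad origins\<close>

text \<open>
  Origins close, on its own scale, to a maximal heavy cell are discarded altogether. From any other
  origin, a maximal heavy cell met at distance about \<open>2^k\<close> has size smaller than \<open>2^k\<close>.
\<close>

definition near_marked :: "(int \<times> int) set \<Rightarrow> nat \<Rightarrow> int \<times> int \<Rightarrow> bool" where
  "near_marked B K p \<longleftrightarrow> (\<exists>y\<in>marked B K.
     cmod (lattice_point p - lattice_point y) \<le> 8 * 2^top_level B K y)"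

lemma card_near_marked:
  assumes fin: "finite B" and finO: "finite X"
  shows "real (card {p\<in>X. near_marked B K p}) \<le> 441 * real (card (marked B K))"
proof -
  let ?H = "marked B K" and ?t = "top_level B K"
  let ?E = "{p\<in>X. near_marked B K p}"
  let ?near = "\<lambda>p q. cmod (lattice_point p - lattice_point q) \<le> 10 * 2^?t q"
  note finH = finite_marked[OF fin, of K]
  have "real (card ?E) = (\<Sum>p\<in>?E. 1)" by simp
  also have "\<dots> \<le> (\<Sum>p\<in>?E. \<Sum>q\<in>?H. if ?near p q then 1 / 4^?t q else 0)"
  proof (rule sum_mono)
    fix p assume "p \<in> ?E"
    then obtain y where y: "y \<in> ?H" "cmod (lattice_point p - lattice_point y) \<le> 8 * 2^?t y"
      by (auto simp: near_marked_def)
    have "(1::real) = (\<Sum>q\<in>cell_set (?t y) y. 1 / 4^?t q)"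
      using sum_top_level_cell[OF y(1)] by simp
    also have "\<dots> \<le> (\<Sum>q\<in>{q\<in>?H. ?near p q}. 1 / 4^?t q)"
    proof (rule sum_mono2)
      show "cell_set (?t y) y \<subseteq> {q\<in>?H. ?near p q}"
      proof
        fix q assume q: "q \<in> cell_set (?t y) y"
        have "cmod (lattice_point p - lattice_point q) \<le> cmod (lattice_point p - lattice_point y) + cmod (lattice_point q - lattice_point y)"
          using norm_triangle_ineq4[of "lattice_point p - lattice_point y" "lattice_point q - lattice_point y"] by simp
        also have "\<dots> \<le> 10 * 2^?t q"
          using y(2) cell_set_dist[OF q] top_level_cell[OF y(1) q] by simp
        finally show "q \<in> {q\<in>?H. ?near p q}" using top_level_cell[OF y(1) q] by simp
      qed
    qed (use finH in auto)
    also have "\<dots> = (\<Sum>q\<in>?H. if ?near p q then 1 / 4^?t q else 0)"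
      using finH by (simp add: sum.inter_filter)
    finally show "(1::real) \<le> (\<Sum>q\<in>?H. if ?near p q then 1 / 4^?t q else 0)" .
  qed
  also have "\<dots> = (\<Sum>q\<in>?H. \<Sum>p\<in>?E. if ?near p q then 1 / 4^?t q else 0)"
    by (rule sum.swap)
  also have "\<dots> \<le> (\<Sum>q\<in>?H. 441)"
  proof (rule sum_mono)
    fix q
    have "(\<Sum>p\<in>?E. if ?near p q then 1 / 4^?t q else (0::real)) = real (card {p\<in>?E. ?near p q}) / 4^?t q"
      using finO by (simp add: sum.inter_filter[symmetric])
    also have "card {p\<in>?E. ?near p q} \<le> card {p. cmod (lattice_point p - lattice_point q) \<le> real (10 * 2^?t q)}"
      by (intro card_mono finite_lattice_ball) auto
    also have "\<dots> \<le> (2 * (10 * 2^?t q) + 1)^2" by (rule card_lattice_ball)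
    also have "\<dots> \<le> (21 * 2^?t q)^2" by (intro power_mono) auto
    also have "\<dots> = 441 * 4^?t q" by (simp add: power_mult_distrib flip: power_mult) (simp add: power_mult mult.commute)
    finally show "(\<Sum>p\<in>?E. if ?near p q then 1 / 4^?t q else (0::real)) \<le> 441"
      by (simp add: divide_right_mono field_simps)
  qed
  finally show ?thesis by simp
qed

text \<open>
  Step \<open>i\<close> of level \<open>k\<close> passes from the radius \<open>2^k + i * 2^(k - l)\<close> to the next one. It is bad if
  the circle it starts from comes close to a heavy cell of at least the size of the step.
\<close>

definition bad_step :: "(int \<times> int) set \<Rightarrow> nat \<Rightarrow> nat \<Rightarrow> nat \<Rightarrow> int \<times> int \<Rightarrow> nat \<Rightarrow> bool" where
  "bad_step B K l k p i \<longleftrightarrow> (\<exists>y\<in>marked B K. k \<le> top_level B K y + l \<and>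
     \<bar>cmod (lattice_point p - lattice_point y) - (2^k + real i * 2^(k - l))\<bar> \<le> 3 * 2^(k - l))"

definition bad_level :: "(int \<times> int) set \<Rightarrow> nat \<Rightarrow> nat \<Rightarrow> int \<times> int \<Rightarrow> nat \<Rightarrow> bool" where
  "bad_level B K l p k \<longleftrightarrow> 2^l < 2 * card {i. i < 2^l \<and> bad_step B K l k p i}"

text \<open>
  The block starts at \<open>2^l + l\<close> rather than at \<open>2^l\<close>, so that all maximal heavy cells that can
  spoil one of its levels for an origin that was not discarded have size between \<open>2^(2^l)\<close> and \<open>2^(2^(l + 1))\<close>. This makes the cell sizes relevant to
  different blocks disjoint.
\<close>

definition bad_block :: "(int \<times> int) set \<Rightarrow> nat \<Rightarrow> int \<times> int \<Rightarrow> nat \<Rightarrow> bool" where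
  "bad_block B K p l \<longleftrightarrow> 2^l < 4 * card {k\<in>{2^l + l..<2^(l + 1)}. bad_level B K l p k}"

lemma arithmetic_progression_count:
  fixes a d r w :: real
  assumes "w > 0" "r \<ge> 0"
  shows "finite {i::nat. \<bar>d - (a + real i * w)\<bar> \<le> r}"
    and "real (card {i::nat. \<bar>d - (a + real i * w)\<bar> \<le> r}) \<le> 2 * r / w + 1"
proof -
  let ?I = "{i::nat. \<bar>d - (a + real i * w)\<bar> \<le> r}"
  define x where "x = (d - r - a) / w"
  define y where "y = (d + r - a) / w"
  have sub: "int ` ?I \<subseteq> {\<lceil>x\<rceil>..\<lfloor>y\<rfloor>}"
  proof
    fix n assume "n \<in> int ` ?I"
    then obtain i where i: "n = int i" "\<bar>d - (a + real i * w)\<bar> \<le> r" by auto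
    then have "x \<le> real i" "real i \<le> y" using assms(1) by (auto simp: x_def y_def field_simps abs_le_iff)
    then show "n \<in> {\<lceil>x\<rceil>..\<lfloor>y\<rfloor>}" using i by (auto simp: ceiling_le_iff le_floor_iff)
  qed
  then have "finite (int ` ?I)" by (rule finite_subset) auto
  then show "finite ?I" by (rule finite_imageD) auto
  have "card ?I = card (int ` ?I)" by (simp add: card_image)
  also have "\<dots> \<le> card {\<lceil>x\<rceil>..\<lfloor>y\<rfloor>}" by (rule card_mono[OF _ sub]) auto
  finally have "real (card ?I) \<le> real (nat (\<lfloor>y\<rfloor> - \<lceil>x\<rceil> + 1))" by (simp add: algebra_simps)
  also have "\<dots> \<le> y - x + 1"
  proof -
    have "x \<le> y" using assms by (auto simp: x_def y_def divide_right_mono)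
    moreover have "real_of_int (\<lfloor>y\<rfloor> - \<lceil>x\<rceil> + 1) \<le> y - x + 1" by linarith
    ultimately show ?thesis by (cases "0 \<le> \<lfloor>y\<rfloor> - \<lceil>x\<rceil> + 1") (simp_all add: of_nat_nat)
  qed
  also have "y - x = 2 * r / w" by (simp add: x_def y_def flip: diff_divide_distrib)
  finally show "real (card ?I) \<le> 2 * r / w + 1" by simp
qed

text \<open>
  The points of a cell of level \<open>j\<close> that spoils step \<open>i\<close> have distance from the origin within
  \<open>5 * 2^j\<close> of the radius of step \<open>i\<close>. So every cell spoils at most \<open>11 * 2^j / 2^(k - l)\<close> steps,
  which is spread over its \<open>4^j\<close> points.
\<close>

lemma card_bad_steps:
  assumes fin: "finite B" and p: "\<not> near_marked B K p" and lk: "l \<le> k"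
  shows "real (card {i. i < 2^l \<and> bad_step B K l k p i}) \<le>
    (\<Sum>q\<in>marked B K. if top_level B K q < k \<and> k \<le> top_level B K q + l \<and>
        cmod (lattice_point p - lattice_point q) \<le> 7 * 2^k
      then 11 / (2^(k - l) * 2^top_level B K q) else 0)"
proof -
  let ?H = "marked B K" and ?t = "top_level B K"
  let ?I = "{i. i < 2^l \<and> bad_step B K l k p i}"
  let ?d = "\<lambda>q. cmod (lattice_point p - lattice_point q)"
  let ?w = "2^(k - l) :: real"
  let ?r = "\<lambda>i::nat. 2^k + real i * 2^(k - l) :: real"
  let ?A = "\<lambda>q. ?t q < k \<and> k \<le> ?t q + l \<and> ?d q \<le> 7 * 2^k"
  let ?near = "\<lambda>i q. ?A q \<and> \<bar>?d q - ?r i\<bar> \<le> 5 * 2^?t q"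
  have finH: "finite ?H" by (rule finite_marked[OF fin])
  have "real (card ?I) = (\<Sum>i\<in>?I. 1)" by simp
  also have "\<dots> \<le> (\<Sum>i\<in>?I. \<Sum>q\<in>?H. if ?near i q then 1 / 4^?t q else 0)"
  proof (rule sum_mono)
    fix i assume i: "i \<in> ?I"
    then obtain y where y: "y \<in> ?H" "k \<le> ?t y + l" "\<bar>?d y - ?r i\<bar> \<le> 3 * ?w"
      by (auto simp: bad_step_def)
    have w_le: "?w \<le> 2^?t y" "?w \<le> 2^k" using y(2) by (auto intro!: power_increasing)
    have "(real i + 1) * ?w \<le> 2^l * ?w"
    proof (rule mult_right_mono)
      have "i + 1 \<le> 2^l" using i by simp
      then have "real (i + 1) \<le> real (2^l)" by (simp only: of_nat_le_iff)
      then show "real i + 1 \<le> 2^l" by simp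
    qed simp
    also have "2^l * ?w = 2^k" using lk by (simp flip: power_add)
    finally have "real i * ?w + ?w \<le> 2^k" by (simp add: distrib_right)
    then have dy: "?d y \<le> 5 * 2^k" using y(3) w_le(2) by linarith
    have ty: "?t y < k"
    proof (rule ccontr)
      assume "\<not> ?t y < k"
      then have "(2::real)^k \<le> 2^?t y" by (intro power_increasing) auto
      with dy have "?d y \<le> 8 * 2^?t y" using zero_less_power[of "2::real" "?t y"] by linarith
      with p y(1) show False by (auto simp: near_marked_def)
    qed
    then have ty': "(2::real)^?t y \<le> 2^k" by (intro power_increasing) auto
    have "(1::real) = (\<Sum>q\<in>cell_set (?t y) y. 1 / 4^?t q)"
      using sum_top_level_cell[OF y(1)] by simp
    also have "\<dots> \<le> (\<Sum>q\<in>{q\<in>?H. ?near i q}. 1 / 4^?t q)"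
    proof (rule sum_mono2)
      show "cell_set (?t y) y \<subseteq> {q\<in>?H. ?near i q}"
      proof
        fix q assume q: "q \<in> cell_set (?t y) y"
        have "\<bar>?d q - ?d y\<bar> \<le> cmod (lattice_point q - lattice_point y)"
          using norm_triangle_ineq3[of "lattice_point p - lattice_point q" "lattice_point p - lattice_point y"]
          by (simp add: norm_minus_commute)
        then have "\<bar>?d q - ?d y\<bar> \<le> 2 * 2^?t y" using cell_set_dist[OF q] by linarith
        then have "?d q \<le> 7 * 2^k" "\<bar>?d q - ?r i\<bar> \<le> 5 * 2^?t y"
          using ty' dy y(3) w_le(1) by linarith+
        then show "q \<in> {q\<in>?H. ?near i q}"
          using top_level_cell[OF y(1) q] ty y(2) by simp
      qed
    qed (use finH in auto)
    also have "\<dots> = (\<Sum>q\<in>?H. if ?near i q then 1 / 4^?t q else 0)"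
      using finH by (simp add: sum.inter_filter)
    finally show "(1::real) \<le> (\<Sum>q\<in>?H. if ?near i q then 1 / 4^?t q else 0)" .
  qed
  also have "\<dots> = (\<Sum>q\<in>?H. \<Sum>i\<in>?I. if ?near i q then 1 / 4^?t q else 0)"
    by (rule sum.swap)
  also have "\<dots> \<le> (\<Sum>q\<in>?H. if ?A q then 11 / (?w * 2^?t q) else 0)"
  proof (rule sum_mono)
    fix q
    show "(\<Sum>i\<in>?I. if ?near i q then 1 / 4^?t q else (0::real)) \<le> (if ?A q then 11 / (?w * 2^?t q) else 0)"
    proof (cases "?A q")
      case True
      then have w_le: "?w \<le> 2^?t q" by (auto intro!: power_increasing)
      have "(\<Sum>i\<in>?I. if ?near i q then 1 / 4^?t q else (0::real)) = real (card {i\<in>?I. ?near i q}) / 4^?t q"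
        by (simp add: sum.inter_filter[symmetric])
      also have "\<dots> \<le> 11 * 2^?t q / ?w / 4^?t q"
      proof (rule divide_right_mono)
        have "real (card {i\<in>?I. ?near i q}) \<le> real (card {i. \<bar>?d q - ?r i\<bar> \<le> 5 * 2^?t q})"
          unfolding of_nat_le_iff by (intro card_mono arithmetic_progression_count(1)) auto
        also have "\<dots> \<le> 2 * (5 * 2^?t q) / ?w + 1"
          by (rule arithmetic_progression_count(2)) auto
        also have "\<dots> \<le> 11 * 2^?t q / ?w" using w_le by (simp add: field_simps)
        finally show "real (card {i\<in>?I. ?near i q}) \<le> 11 * 2^?t q / ?w" .
      qed simp
      also have "\<dots> = 11 / (?w * 2^?t q)"
      proof -
        have "(4::real)^?t q = 2^?t q * 2^?t q" by (simp flip: power_mult_distrib)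
        then show ?thesis by (simp add: field_simps)
      qed
      finally show ?thesis using True by simp
    next
      case False
      then have "\<And>i. \<not> ?near i q" by blast
      then show ?thesis using False by (simp only: if_False) simp
    qed
  qed
  finally show ?thesis .
qed

text \<open>
  Summing the previous bound over the origins: a point is within \<open>7 * 2^k\<close> of at most
  \<open>(15 * 2^k)^2\<close> origins. Markov's inequality then costs the factor \<open>2 / 2^l\<close>.
\<close>

lemma card_bad_level:
  assumes fin: "finite B" and finX: "finite X" and lk: "l \<le> k"
  shows "real (card {p\<in>X. \<not> near_marked B K p \<and> bad_level B K l p k}) \<le>
    4950 * (\<Sum>q\<in>marked B K. if top_level B K q < k \<and> k \<le> top_level B K q + l
      then 2^k / 2^top_level B K q else 0)"
proof -
  let ?H = "marked B K" and ?t = "top_level B K"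
  let ?d = "\<lambda>p q. cmod (lattice_point p - lattice_point q)"
  let ?E = "{p\<in>X. \<not> near_marked B K p \<and> bad_level B K l p k}"
  let ?A = "\<lambda>q. ?t q < k \<and> k \<le> ?t q + l"
  let ?v = "\<lambda>q. 11 / (2^(k - l) * 2^?t q) :: real"
  have "2^l * real (card ?E) = (\<Sum>p\<in>?E. 2^l)" by simp
  also have "\<dots> \<le> (\<Sum>p\<in>?E. 2 * (\<Sum>q\<in>?H. if ?t q < k \<and> k \<le> ?t q + l \<and> ?d p q \<le> 7 * 2^k then ?v q else 0))"
  proof (rule sum_mono)
    fix p assume p: "p \<in> ?E"
    then have "real (2^l) \<le> real (2 * card {i. i < 2^l \<and> bad_step B K l k p i})"
      unfolding bad_level_def of_nat_le_iff by simp
    with card_bad_steps[OF fin _ lk, of K p] p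
    show "2^l \<le> 2 * (\<Sum>q\<in>?H. if ?t q < k \<and> k \<le> ?t q + l \<and> ?d p q \<le> 7 * 2^k then ?v q else 0)" by auto
  qed
  also have "\<dots> = (\<Sum>q\<in>?H. \<Sum>p\<in>?E. if ?t q < k \<and> k \<le> ?t q + l \<and> ?d p q \<le> 7 * 2^k then 2 * ?v q else 0)"
    unfolding sum_distrib_left by (subst sum.swap) (intro sum.cong, auto)
  also have "\<dots> \<le> (\<Sum>q\<in>?H. if ?A q then 4950 * 2^l * (2^k / 2^?t q) else 0)"
  proof (rule sum_mono)
    fix q
    show "(\<Sum>p\<in>?E. if ?t q < k \<and> k \<le> ?t q + l \<and> ?d p q \<le> 7 * 2^k then 2 * ?v q else 0)
      \<le> (if ?A q then 4950 * 2^l * (2^k / 2^?t q) else 0)"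
    proof (cases "?A q")
      case True
      have "(\<Sum>p\<in>?E. if ?t q < k \<and> k \<le> ?t q + l \<and> ?d p q \<le> 7 * 2^k then 2 * ?v q else 0)
          = real (card {p\<in>?E. ?d p q \<le> 7 * 2^k}) * (2 * ?v q)"
        using True finX by (simp add: sum.inter_filter[symmetric])
      also have "\<dots> \<le> real ((15 * 2^k)^2) * (2 * ?v q)"
      proof (intro mult_right_mono of_nat_mono)
        have "card {p\<in>?E. ?d p q \<le> 7 * 2^k} \<le> card {p. ?d p q \<le> real (7 * 2^k)}"
          by (intro card_mono finite_lattice_ball) auto
        also have "\<dots> \<le> (2 * (7 * 2^k) + 1)^2" by (rule card_lattice_ball)
        also have "\<dots> \<le> (15 * 2^k)^2" by (intro power_mono) auto
        finally show "card {p\<in>?E. ?d p q \<le> 7 * 2^k} \<le> (15 * 2^k)^2" .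
      qed simp
      also have "\<dots> = 4950 * 2^l * (2^k / 2^?t q)"
      proof -
        have "(2::real)^k = 2^l * 2^(k - l)" using lk by (simp flip: power_add)
        then show ?thesis by (simp add: field_simps power2_eq_square)
      qed
      finally show ?thesis using True by simp
    next
      case False
      then show ?thesis by auto
    qed
  qed
  also have "\<dots> = 2^l * (4950 * (\<Sum>q\<in>?H. if ?A q then 2^k / 2^?t q else 0))"
    unfolding sum_distrib_left by (intro sum.cong) auto
  finally show ?thesis by simp
qed

text \<open>
  Markov's inequality over the levels of the block. For a fixed point the sum over the levels is
  geometric, dominated by the largest level \<open>k = j + l\<close>, and of order \<open>2^l\<close>; this cancels against
  the number of levels of the block.
\<close>

lemma card_bad_block:
  assumes fin: "finite B" and finX: "finite X"
  shows "real (card {p\<in>X. \<not> near_marked B K p \<and> bad_block B K p l}) \<le>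
    39600 * real (card {q\<in>marked B K. 2^l \<le> top_level B K q \<and> top_level B K q < 2^(l + 1)})"
proof -
  let ?H = "marked B K" and ?t = "top_level B K"
  let ?E = "{p\<in>X. \<not> near_marked B K p \<and> bad_block B K p l}"
  let ?L = "{2^l + l..<2^(l + 1)} :: nat set"
  let ?A = "\<lambda>q k. ?t q < k \<and> k \<le> ?t q + l"
  have finH: "finite ?H" by (rule finite_marked[OF fin])
  have "2^l * real (card ?E) = (\<Sum>p\<in>?E. 2^l)" by simp
  also have "\<dots> \<le> (\<Sum>p\<in>?E. \<Sum>k\<in>?L. if bad_level B K l p k then 4 else 0)"
  proof (rule sum_mono)
    fix p assume "p \<in> ?E"
    then have "real (2^l) \<le> real (4 * card {k\<in>?L. bad_level B K l p k})"
      unfolding bad_block_def of_nat_le_iff by simp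
    then show "2^l \<le> (\<Sum>k\<in>?L. if bad_level B K l p k then 4 else (0::real))"
      by (simp add: sum.inter_filter[symmetric])
  qed
  also have "\<dots> = (\<Sum>k\<in>?L. \<Sum>p\<in>?E. if bad_level B K l p k then 4 else 0)" by (rule sum.swap)
  also have "\<dots> \<le> (\<Sum>k\<in>?L. 4 * (4950 * (\<Sum>q\<in>?H. if ?A q k then 2^k / 2^?t q else 0)))"
  proof (rule sum_mono)
    fix k assume "k \<in> ?L"
    then have lk: "l \<le> k" by auto
    have "(\<Sum>p\<in>?E. if bad_level B K l p k then 4 else (0::real)) = 4 * real (card {p\<in>?E. bad_level B K l p k})"
      using finX by (simp add: sum.inter_filter[symmetric])
    also have "card {p\<in>?E. bad_level B K l p k} \<le> card {p\<in>X. \<not> near_marked B K p \<and> bad_level B K l p k}"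
      by (intro card_mono) (use finX in auto)
    finally show "(\<Sum>p\<in>?E. if bad_level B K l p k then 4 else (0::real)) \<le>
        4 * (4950 * (\<Sum>q\<in>?H. if ?A q k then 2^k / 2^?t q else 0))"
      using card_bad_level[OF fin finX lk, of K] by simp
  qed
  also have "\<dots> = (\<Sum>q\<in>?H. \<Sum>k\<in>?L. if ?A q k then 19800 * (2^k / 2^?t q) else 0)"
    unfolding sum_distrib_left by (subst sum.swap) (intro sum.cong, auto)
  also have "\<dots> \<le> (\<Sum>q\<in>?H. if 2^l \<le> ?t q \<and> ?t q < 2^(l + 1) then 39600 * 2^l else 0)"
  proof (rule sum_mono)
    fix q
    show "(\<Sum>k\<in>?L. if ?A q k then 19800 * (2^k / 2^?t q) else 0) \<le>
      (if 2^l \<le> ?t q \<and> ?t q < 2^(l + 1) then 39600 * 2^l else (0::real))"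
    proof (cases "2^l \<le> ?t q \<and> ?t q < 2^(l + 1)")
      case True
      have "(\<Sum>k\<in>?L. if ?A q k then 19800 * (2^k / 2^?t q) else (0::real)) = (\<Sum>k\<in>{k\<in>?L. ?A q k}. 19800 * (2^k / 2^?t q))"
        by (rule sum.inter_filter[symmetric]) simp
      also have "\<dots> \<le> (\<Sum>k\<in>{..<?t q + l + 1}. 19800 * (2^k / 2^?t q))"
        by (rule sum_mono2) auto
      also have "\<dots> = 19800 / 2^?t q * (\<Sum>k\<in>{..<?t q + l + 1}. 2^k)"
        unfolding sum_distrib_left by (intro sum.cong) auto
      also have "\<dots> \<le> 19800 / 2^?t q * 2^(?t q + l + 1)"
      proof (intro mult_left_mono)
        show "(\<Sum>k<n. (2::real)^k) \<le> 2^n" for n by (simp add: geometric_sum)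
      qed simp
      also have "\<dots> = 39600 * 2^l" by (simp add: power_add)
      finally show ?thesis using True by simp
    next
      case False
      then have "\<not> ?A q k" if "k \<in> ?L" for k using that by auto
      then show ?thesis using False by (simp add: sum.neutral)
    qed
  qed
  also have "\<dots> = 2^l * (39600 * real (card {q\<in>?H. 2^l \<le> ?t q \<and> ?t q < 2^(l + 1)}))"
    using finH by (simp add: sum.inter_filter[symmetric])
  finally show ?thesis by simp
qed

text \<open>
  The bound does not depend on the number of blocks, because every marked point has its level in at
  most one block.
\<close>

lemma card_bad_origins:
  assumes fin: "finite B" and finX: "finite X"
  shows "real (card {p\<in>X. near_marked B K p \<or> (\<exists>l\<le>L. bad_block B K p l)}) \<le> 11531808 * real (card B)"
proof -
  let ?H = "marked B K" and ?t = "top_level B K"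
  let ?N = "{p\<in>X. near_marked B K p}"
  let ?E = "\<lambda>l. {p\<in>X. \<not> near_marked B K p \<and> bad_block B K p l}"
  let ?T = "\<lambda>l. {q\<in>?H. 2^l \<le> ?t q \<and> ?t q < 2^(l + 1)}"
  have finH: "finite ?H" by (rule finite_marked[OF fin])
  have "card {p\<in>X. near_marked B K p \<or> (\<exists>l\<le>L. bad_block B K p l)} \<le> card (?N \<union> (\<Union>l\<le>L. ?E l))"
    by (intro card_mono) (use finX in auto)
  also have "\<dots> \<le> card ?N + card (\<Union>l\<le>L. ?E l)" by (rule card_Un_le)
  also have "card (\<Union>l\<le>L. ?E l) \<le> (\<Sum>l\<le>L. card (?E l))" by (rule card_UN_le) auto
  finally have "real (card {p\<in>X. near_marked B K p \<or> (\<exists>l\<le>L. bad_block B K p l)})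
      \<le> real (card ?N) + (\<Sum>l\<le>L. real (card (?E l)))"
    by (simp flip: of_nat_sum of_nat_add)
  also have "\<dots> \<le> 441 * real (card ?H) + (\<Sum>l\<le>L. 39600 * real (card (?T l)))"
    by (intro add_mono sum_mono card_near_marked card_bad_block fin finX)
  also have "(\<Sum>l\<le>L. 39600 * real (card (?T l))) = 39600 * real (card (\<Union>l\<le>L. ?T l))"
  proof -
    have "l = l'" if "2^l \<le> n" "n < 2^(l + 1)" "2^l' \<le> n" "n < 2^(l' + 1)" for l l' n :: nat
    proof -
      have "(2::nat)^l < 2^(l' + 1)" "(2::nat)^l' < 2^(l + 1)" using that by linarith+
      then have "l < l' + 1" "l' < l + 1" by (simp_all only: power_strict_increasing_iff)
      then show ?thesis by simp
    qed
    then have "card (\<Union>l\<le>L. ?T l) = (\<Sum>l\<le>L. card (?T l))"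
      using finH by (intro card_UN_disjoint) auto
    then show ?thesis by (simp add: sum_distrib_left)
  qed
  also have "card (\<Union>l\<le>L. ?T l) \<le> card ?H" by (intro card_mono finH) auto
  finally show ?thesis using card_marked[OF fin, of K] by simp
qed

section \<open>Doubling of the logarithmic growth\<close>

definition lattice_floor :: "complex \<Rightarrow> int \<times> int" where
  "lattice_floor z = (\<lfloor>Re z\<rfloor>, \<lfloor>Im z\<rfloor>)"

text \<open>
  Half-open unit squares, indexed by their lower left corners.
\<close>

definition large_squares :: "(complex \<Rightarrow> complex) \<Rightarrow> (int \<times> int) set" where
  "large_squares g = {p. \<exists>z. lattice_floor z = p \<and> 1 < cmod (g z)}"

text \<open>
  The maximum of \<open>max 0 (ln \<bar>g\<bar>)\<close> over a closed disc.
\<close>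

definition log_growth :: "(complex \<Rightarrow> complex) \<Rightarrow> complex \<Rightarrow> real \<Rightarrow> real" where
  "log_growth g c r = ln (max 1 (SUP z\<in>cball c r. cmod (g z)))"

lemma lattice_floor_eq_dist:
  assumes "lattice_floor z = lattice_floor z'"
  shows "cmod (z - z') < 2"
proof -
  have "\<bar>Re (z - z')\<bar> < 1" "\<bar>Im (z - z')\<bar> < 1"
    using assms unfolding lattice_floor_def by (auto simp: abs_less_iff) linarith+
  then show ?thesis using cmod_le[of "z - z'"] by linarith
qed

lemma max_on_sphere:
  fixes g :: "complex \<Rightarrow> complex"
  assumes g: "g holomorphic_on UNIV" and t: "t > 0"
  obtains z where "cmod (z - c) = t" "\<And>x. x \<in> cball c t \<Longrightarrow> cmod (g x) \<le> cmod (g z)"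
proof -
  have cont: "continuous_on S g" for S
    using holomorphic_on_imp_continuous_on[OF g] continuous_on_subset by blast
  have "\<exists>z\<in>sphere c t. \<forall>y\<in>sphere c t. cmod (g y) \<le> cmod (g z)"
    using t by (intro continuous_attains_sup continuous_on_norm cont) auto
  then obtain z where z: "z \<in> sphere c t" "\<And>y. y \<in> sphere c t \<Longrightarrow> cmod (g y) \<le> cmod (g z)"
    by blast
  show thesis
  proof (rule that)
    show "cmod (z - c) = t" using z(1) by (simp add: dist_norm norm_minus_commute)
    fix x assume x: "x \<in> cball c t"
    show "cmod (g x) \<le> cmod (g z)"
    proof (rule maximum_modulus_frontier[of g "cball c t"])
      show "g holomorphic_on interior (cball c t)" by (rule holomorphic_on_subset[OF g]) simp
      show "cmod (g y) \<le> cmod (g z)" if "y \<in> frontier (cball c t)" for y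
        using that t z(2) by (simp add: frontier_cball)
    qed (use x cont in auto)
  qed
qed

text \<open>
  A discrete sub-mean value property of \<open>max 0 (ln \<bar>g\<bar>)\<close>: the product of the rotated and dilated
  copies \<open>g (c + p * \<zeta>)\<close> is \<open>g c ^ card P\<close> at \<open>\<zeta> = 0\<close>, so it is at least as large somewhere on
  the unit circle. There the points \<open>c + p * \<zeta>\<close> are as separated as \<open>P\<close>, hence
  lie in different unit squares, and each large square contributes at most one factor above \<open>1\<close>.
\<close>

lemma submean_power:
  fixes g :: "complex \<Rightarrow> complex"
  assumes g: "g holomorphic_on UNIV"
    and S: "S \<ge> 1" "\<And>z. cmod (z - c) \<le> r \<Longrightarrow> cmod (g z) \<le> S"
    and P: "finite P" "\<And>p. p \<in> P \<Longrightarrow> cmod p \<le> r"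
      "\<And>p q. p \<in> P \<Longrightarrow> q \<in> P \<Longrightarrow> p \<noteq> q \<Longrightarrow> 2 \<le> cmod (p - q)"
    and E: "finite E" "large_squares g \<inter> lattice_floor ` cball c r \<subseteq> E"
  shows "cmod (g c) ^ card P \<le> S ^ card E"
proof -
  define G where "G z = (\<Prod>p\<in>P. g (c + p * z))" for z
  have "G holomorphic_on UNIV"
    unfolding G_def
    by (intro holomorphic_on_prod holomorphic_on_compose_gen[OF _ g, unfolded comp_def] holomorphic_intros) auto
  then obtain z where z: "cmod (z - 0) = 1" "\<And>x. x \<in> cball 0 1 \<Longrightarrow> cmod (G x) \<le> cmod (G z)"
    by (rule max_on_sphere[of G 1 0]) auto
  let ?x = "\<lambda>p. c + p * z"
  let ?E = "{p\<in>P. 1 < cmod (g (?x p))}"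
  have x: "?x p \<in> cball c r" if "p \<in> P" for p
    using P(2)[OF that] z(1) by (simp add: dist_norm norm_mult)
  have inj: "inj_on (\<lambda>p. lattice_floor (?x p)) P"
  proof (rule inj_onI, rule ccontr)
    fix p q assume pq: "p \<in> P" "q \<in> P" "lattice_floor (?x p) = lattice_floor (?x q)" "p \<noteq> q"
    have "cmod (?x p - ?x q) = cmod (p - q)"
      using z(1) by (simp add: norm_mult flip: left_diff_distrib)
    with lattice_floor_eq_dist[OF pq(3)] P(3)[OF pq(1,2,4)] show False by simp
  qed
  have "card ?E = card ((\<lambda>p. lattice_floor (?x p)) ` ?E)"
    by (intro card_image[symmetric] inj_on_subset[OF inj]) auto
  also have "\<dots> \<le> card E"
    using E x by (intro card_mono) (auto simp: large_squares_def)
  finally have cardE: "card ?E \<le> card E" .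
  have "cmod (g c) ^ card P = cmod (G 0)" by (simp add: G_def norm_power)
  also have "\<dots> \<le> cmod (G z)" by (rule z(2)) simp
  also have "\<dots> = (\<Prod>p\<in>P. cmod (g (?x p)))" by (simp add: G_def prod_norm)
  also have "\<dots> \<le> (\<Prod>p\<in>P. if 1 < cmod (g (?x p)) then S else 1)"
    using S(2) x by (intro prod_mono) (auto simp: dist_norm norm_minus_commute)
  also have "\<dots> = S ^ card ?E" using P(1) by (simp add: prod.inter_filter[symmetric])
  also have "\<dots> \<le> S ^ card E" using S(1) cardE by (rule power_increasing[rotated])
  finally show ?thesis .
qed

lemma bdd_above_norm_cball:
  fixes g :: "complex \<Rightarrow> complex"
  assumes "g holomorphic_on UNIV"
  shows "bdd_above ((\<lambda>z. cmod (g z)) ` cball c r)"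
proof -
  have "compact ((\<lambda>z. cmod (g z)) ` cball c r)"
    by (intro compact_continuous_image continuous_on_norm
        continuous_on_subset[OF holomorphic_on_imp_continuous_on[OF assms]]) auto
  then show ?thesis by (intro bounded_imp_bdd_above compact_imp_bounded)
qed

lemma log_growth_nonneg: "0 \<le> log_growth g c r"
  by (simp add: log_growth_def)

lemma norm_le_exp_log_growth:
  assumes "g holomorphic_on UNIV" "z \<in> cball c r"
  shows "cmod (g z) \<le> exp (log_growth g c r)"
proof -
  have "cmod (g z) \<le> (SUP z\<in>cball c r. cmod (g z))"
    by (rule cSUP_upper[OF assms(2) bdd_above_norm_cball[OF assms(1)]])
  also have "\<dots> \<le> max 1 (SUP z\<in>cball c r. cmod (g z))" by simp
  finally show ?thesis unfolding log_growth_def by (subst exp_ln) auto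
qed

lemma log_growth_le:
  assumes "0 \<le> r" "\<And>z. z \<in> cball c r \<Longrightarrow> cmod (g z) \<le> exp u" "0 \<le> u"
  shows "log_growth g c r \<le> u"
proof -
  have "(SUP z\<in>cball c r. cmod (g z)) \<le> exp u"
    using assms by (intro cSUP_least) auto
  then have "ln (max 1 (SUP z\<in>cball c r. cmod (g z))) \<le> ln (exp u)"
    using assms(3) by (intro ln_mono) auto
  then show ?thesis by (simp add: log_growth_def)
qed

lemma log_growth_mono:
  assumes "g holomorphic_on UNIV" "0 \<le> r" "r \<le> s"
  shows "log_growth g c r \<le> log_growth g c s"
  using assms by (intro log_growth_le norm_le_exp_log_growth log_growth_nonneg) auto

text \<open>
  The previous lemma at a maximum point on the circle of radius \<open>t\<close>, with a square array of
  \<open>4^n / 16\<close> points at mutual distance at least \<open>2\<close>. If at most half as many large squares meet the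
  disc of radius \<open>2^n\<close> around it, the value there is at most the square root of the maximum over
  the larger disc.
\<close>

lemma log_growth_double:
  assumes g: "g holomorphic_on UNIV" and t: "t > 0" and n: "2 \<le> n"
    and few: "\<And>z. cmod (z - c) = t \<Longrightarrow> \<exists>E. finite E \<and> 32 * card E \<le> 4^n \<and>
                 large_squares g \<inter> lattice_floor ` cball z (2^n) \<subseteq> E"
  shows "2 * log_growth g c t \<le> log_growth g c (t + 2^n)"
proof -
  obtain z where z: "cmod (z - c) = t" "\<And>x. x \<in> cball c t \<Longrightarrow> cmod (g x) \<le> cmod (g z)"
    using max_on_sphere[OF g t] by blast
  obtain E where E: "finite E" "32 * card E \<le> 4^n"
      "large_squares g \<inter> lattice_floor ` cball z (2^n) \<subseteq> E"
    using few[OF z(1)] by blast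
  define h :: nat where "h = 2^(n - 2)"
  have h: "4 * h = 2^n"
  proof -
    obtain m where "n = m + 2" using n by (metis add.commute le_iff_add)
    then show ?thesis by (simp add: h_def power_add)
  qed
  have h2: "16 * h^2 = 4^n"
  proof -
    have "16 * h^2 = (4 * h)^2" by (simp add: power_mult_distrib)
    also have "\<dots> = (2^2)^n" unfolding h by (simp only: power_mult[symmetric] mult.commute)
    finally show ?thesis by simp
  qed
  define P where "P = (\<lambda>(a, b). Complex (2 * real a) (2 * real b)) ` ({..<h} \<times> {..<h})"
  have cardP: "card P = h^2"
    unfolding P_def by (subst card_image) (auto simp: inj_on_def power2_eq_square)
  let ?S = "exp (log_growth g c (t + 2^n))"
  have "cmod (g z) ^ card P \<le> ?S ^ card E"
  proof (rule submean_power[OF g])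
    fix x assume "cmod (x - z) \<le> 2^n"
    then have "cmod (x - c) \<le> t + 2^n" using z(1) norm_triangle_ineq[of "x - z" "z - c"] by simp
    then show "cmod (g x) \<le> ?S"
      by (intro norm_le_exp_log_growth[OF g]) (simp add: dist_norm norm_minus_commute)
  next
    fix p assume "p \<in> P"
    then obtain a b where ab: "p = Complex (2 * real a) (2 * real b)" "a < h" "b < h"
      by (auto simp: P_def)
    have "cmod p \<le> 2 * real a + 2 * real b" using cmod_le[of p] by (simp add: ab)
    also have "\<dots> \<le> real (4 * h)" using ab by simp
    finally show "cmod p \<le> 2^n" by (simp add: h)
  next
    fix p q assume pq: "p \<in> P" "q \<in> P" "p \<noteq> q"
    then obtain a b a' b' where ab: "p = Complex (2 * real a) (2 * real b)" "q = Complex (2 * real a') (2 * real b')"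
      by (auto simp: P_def)
    then have "a \<noteq> a' \<or> b \<noteq> b'" using pq by auto
    then have "2 \<le> \<bar>Re (p - q)\<bar> \<or> 2 \<le> \<bar>Im (p - q)\<bar>" by (auto simp: ab)
    then show "2 \<le> cmod (p - q)" using abs_Re_le_cmod[of "p - q"] abs_Im_le_cmod[of "p - q"] by linarith
  qed (use E in \<open>auto simp: P_def log_growth_nonneg\<close>)
  also have "\<dots> = exp (real (card E) * log_growth g c (t + 2^n))" by (simp add: exp_of_nat_mult)
  finally have *: "cmod (g z) ^ h^2 \<le> exp (real (card E) * log_growth g c (t + 2^n))" by (simp add: cardP)
  have "2 * card E \<le> h^2" using E(2) h2 by linarith
  then have "real (2 * card E) \<le> real (h^2)" by (simp only: of_nat_le_iff)
  then have "real (card E) \<le> real (h^2) / 2" by simp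
  then have "real (card E) * log_growth g c (t + 2^n) \<le> real (h^2) / 2 * log_growth g c (t + 2^n)"
    by (intro mult_right_mono log_growth_nonneg)
  also have "\<dots> = real (h^2) * (log_growth g c (t + 2^n) / 2)" by simp
  finally have "exp (real (card E) * log_growth g c (t + 2^n)) \<le> exp (log_growth g c (t + 2^n) / 2) ^ h^2"
    by (simp only: exp_of_nat_mult[symmetric] exp_le_cancel_iff)
  with * have "cmod (g z) ^ h^2 \<le> exp (log_growth g c (t + 2^n) / 2) ^ h^2" by (rule order_trans)
  moreover have "0 < h^2" by (simp add: h_def)
  ultimately have "cmod (g z) \<le> exp (log_growth g c (t + 2^n) / 2)"
    by simp
  then have "log_growth g c t \<le> log_growth g c (t + 2^n) / 2"
  proof (intro log_growth_le)
    fix x assume "x \<in> cball c t" "cmod (g z) \<le> exp (log_growth g c (t + 2^n) / 2)"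
    then show "cmod (g x) \<le> exp (log_growth g c (t + 2^n) / 2)"
      using z(2)[of x] by linarith
  qed (use t log_growth_nonneg[of g c "t + 2^n"] in auto)
  then show ?thesis by simp
qed

section \<open>Growth around a good origin\<close>

lemma growth_iterate:
  fixes m :: "nat \<Rightarrow> real"
  assumes "a \<le> c" "1 \<le> b" "\<And>k. 0 \<le> m k" "\<And>k. m k \<le> m (Suc k)"
    and good: "\<And>k. a \<le> k \<Longrightarrow> k < c \<Longrightarrow> P k \<Longrightarrow> b * m k \<le> m (Suc k)"
  shows "b ^ card {k\<in>{a..<c}. P k} * m a \<le> m c"
  using assms(1) good
proof (induction c rule: dec_induct)
  case (step n)
  have IH: "b ^ card {k\<in>{a..<n}. P k} * m a \<le> m n" by (rule step.IH) (use step.prems in auto)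
  show ?case
  proof (cases "P n")
    case True
    have "{k\<in>{a..<Suc n}. P k} = insert n {k\<in>{a..<n}. P k}" using True step.hyps by auto
    then have "b ^ card {k\<in>{a..<Suc n}. P k} * m a = b * (b ^ card {k\<in>{a..<n}. P k} * m a)" by simp
    also have "\<dots> \<le> b * m n" using IH assms(2) by (intro mult_left_mono) auto
    also have "\<dots> \<le> m (Suc n)" using step.prems[of n] step.hyps True by simp
    finally show ?thesis .
  next
    case False
    have "{k\<in>{a..<Suc n}. P k} = {k\<in>{a..<n}. P k}" using False by (auto simp: less_Suc_eq)
    then show ?thesis using IH assms(4)[of n] by simp
  qed
qed simp

lemma div_shift: "m > 0 \<Longrightarrow> (x + a * m) div m = x div m + (a::int)"
  by simp

lemma div_near:
  assumes "m > (0::int)" "x - m \<le> y" "y \<le> x + m"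
  shows "y div m - x div m \<in> {-1, 0, 1}"
proof -
  have "(x + (-1) * m) div m \<le> y div m" "y div m \<le> (x + 1 * m) div m"
    using assms by (intro zdiv_mono1; simp)+
  then have "- 1 \<le> y div m - x div m" "y div m - x div m \<le> 1"
    unfolding div_shift[OF assms(1)] by linarith+
  then show ?thesis by auto
qed

text \<open>
  Were there too many large squares near a maximum point, one of the nine cells around it would be
  heavy, and the step bad.
\<close>

lemma step_growth:
  assumes g: "g holomorphic_on UNIV" and fin: "finite W"
    and W: "lattice_floor ` cball (lattice_point p) (2^K) \<subseteq> W"
    and k: "l + 2 \<le> k" "k < K" and i: "i < 2^l"
    and good: "\<not> bad_step (large_squares g \<inter> W) K l k p i"
  shows "2 * log_growth g (lattice_point p) (2^k + real i * 2^(k - l))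
         \<le> log_growth g (lattice_point p) (2^k + real (Suc i) * 2^(k - l))"
proof -
  define B where "B = large_squares g \<inter> W"
  define n where "n = k - l"
  define N :: int where "N = 2^n"
  let ?c = "lattice_point p"
  let ?t = "2^k + real i * 2^n"
  have n: "2 \<le> n" "n \<le> K" using k by (auto simp: n_def)
  have finB: "finite B" using fin by (simp add: B_def)
  have four: "(4::real) \<le> 2^n" using power_increasing[OF n(1), of "2::real"] by simp
  have t_le: "?t + 2^n \<le> 2^K"
  proof -
    have "real (i + 1) \<le> real (2^l)" using i by (subst of_nat_le_iff) simp
    then have "(real i + 1) * 2^n \<le> 2^l * 2^n" by (intro mult_right_mono) auto
    also have "\<dots> = (2::real)^k" using k by (simp add: n_def flip: power_add)
    finally have "?t + 2^n \<le> 2^(Suc k)" by (simp add: distrib_right)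
    also have "\<dots> \<le> 2^K" using k by (intro power_increasing) auto
    finally show ?thesis .
  qed
  have "2 * log_growth g ?c ?t \<le> log_growth g ?c (?t + 2^n)"
  proof (rule log_growth_double[OF g _ n(1)])
    show "0 < ?t" by (simp add: add_pos_nonneg)
    fix z assume z: "cmod (z - ?c) = ?t"
    define q0 where "q0 = lattice_floor z"
    define y where "y = (\<lambda>(a, b). (fst q0 + a * N, snd q0 + b * N))"
    \<comment> \<open>\<open>y d\<close> for \<open>d \<in> D\<close> runs through one point of each of the nine cells that can meet the
      disc of radius \<open>2^n\<close> around \<open>z\<close>.\<close>
    define D :: "(int \<times> int) set" where "D = {-1, 0, 1} \<times> {-1, 0, 1}"
    define E where "E = (\<Union>d\<in>D. B \<inter> cell_set n (y d))"
    have light: "\<not> heavy B n (y d)" if d: "d \<in> D" for d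
    proof
      assume "heavy B n (y d)"
      then have yd: "y d \<in> marked B K" "n \<le> top_level B K (y d)"
        using n by (auto simp: marked_def intro: top_level_ge)
      obtain a b where ab: "d = (a, b)" "a \<in> {-1, 0, 1}" "b \<in> {-1, 0, 1}"
        using d by (auto simp: D_def)
      have aN: "\<bar>real_of_int (a * N)\<bar> \<le> 2^n" "\<bar>real_of_int (b * N)\<bar> \<le> 2^n"
        using ab(2,3) by (auto simp: N_def)
      have "\<bar>Re (z - lattice_point (y d))\<bar> \<le> 1 + 2^n" "\<bar>Im (z - lattice_point (y d))\<bar> \<le> 1 + 2^n"
        using aN unfolding lattice_point_def y_def q0_def lattice_floor_def ab by simp_all linarith+
      then have "cmod (z - lattice_point (y d)) \<le> 3 * 2^n"
        using cmod_le[of "z - lattice_point (y d)"] four by linarith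
      moreover have "\<bar>cmod (?c - lattice_point (y d)) - ?t\<bar> \<le> cmod (z - lattice_point (y d))"
        using norm_triangle_ineq3[of "?c - lattice_point (y d)" "?c - z"] z
        by (simp add: norm_minus_commute)
      ultimately have "bad_step B K l k p i"
        unfolding bad_step_def using yd k by (intro bexI[of _ "y d"]) (auto simp: n_def)
      then show False using good by (simp add: B_def)
    qed
    have "card E \<le> (\<Sum>d\<in>D. card (B \<inter> cell_set n (y d)))"
      unfolding E_def by (rule card_UN_le) (simp add: D_def)
    moreover have "(\<Sum>d\<in>D. 288 * card (B \<inter> cell_set n (y d))) \<le> (\<Sum>d\<in>D. 4^n)"
      using light by (intro sum_mono less_imp_le) (simp add: heavy_def not_le)
    moreover have "card D = 9" by (simp add: D_def card_cartesian_product)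
    ultimately have "32 * card E \<le> 4^n" by (simp flip: sum_distrib_left)
    moreover have "large_squares g \<inter> lattice_floor ` cball z (2^n) \<subseteq> E"
    proof
      fix q assume "q \<in> large_squares g \<inter> lattice_floor ` cball z (2^n)"
      then obtain x where x: "q = lattice_floor x" "x \<in> cball z (2^n)" and q: "q \<in> large_squares g" by auto
      have xz: "cmod (x - z) \<le> 2^n" using x(2) by (simp add: dist_norm norm_minus_commute)
      have "cmod (x - ?c) \<le> cmod (x - z) + cmod (z - ?c)" using norm_triangle_ineq[of "x - z" "z - ?c"] by simp
      then have "x \<in> cball ?c (2^K)" using xz z t_le by (simp add: dist_norm norm_minus_commute)
      then have qB: "q \<in> B" using W q x(1) by (auto simp: B_def)
      have "\<bar>Re x - Re z\<bar> \<le> real_of_int N" "\<bar>Im x - Im z\<bar> \<le> real_of_int N"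
        using xz abs_Re_le_cmod[of "x - z"] abs_Im_le_cmod[of "x - z"] by (auto simp: N_def)
      then have near: "fst q0 - N \<le> fst q" "fst q \<le> fst q0 + N" "snd q0 - N \<le> snd q" "snd q \<le> snd q0 + N"
        unfolding x(1) q0_def lattice_floor_def by simp_all linarith+
      have N: "N > 0" by (simp add: N_def)
      let ?d = "(fst q div N - fst q0 div N, snd q div N - snd q0 div N)"
      have "?d \<in> D" unfolding D_def by (intro SigmaI div_near[OF N] near)
      moreover have "q \<in> cell_set n (y ?d)"
        using N by (simp add: cell_set_def cell_def y_def div_shift flip: N_def)
      ultimately show "q \<in> E" using qB by (auto simp: E_def)
    qed
    moreover have "finite E" using finB by (auto simp: E_def D_def)
    ultimately show "\<exists>E. finite E \<and> 32 * card E \<le> 4^n \<and> large_squares g \<inter> lattice_floor ` cball z (2^n) \<subseteq> E"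
      by blast
  qed
  then show ?thesis by (simp add: n_def algebra_simps)
qed

lemma level_growth:
  assumes g: "g holomorphic_on UNIV" and fin: "finite W"
    and W: "lattice_floor ` cball (lattice_point p) (2^K) \<subseteq> W"
    and k: "l + 2 \<le> k" "k < K" and l: "1 \<le> l"
    and good: "\<not> bad_level (large_squares g \<inter> W) K l p k"
  shows "2^(2^(l - 1)) * log_growth g (lattice_point p) (2^k) \<le> log_growth g (lattice_point p) (2^(Suc k))"
proof -
  let ?B = "large_squares g \<inter> W"
  let ?c = "lattice_point p"
  let ?m = "\<lambda>i. log_growth g ?c (2^k + real i * 2^(k - l))"
  let ?G = "{i\<in>{0..<2^l}. \<not> bad_step ?B K l k p i}"
  let ?I = "{i. i < 2^l \<and> bad_step ?B K l k p i}"
  have "2 ^ card ?G * ?m 0 \<le> ?m (2^l)"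
  proof (rule growth_iterate)
    fix i
    show "?m i \<le> ?m (Suc i)" by (rule log_growth_mono[OF g]) (auto simp: mult_right_mono)
    assume "i < 2^l" "\<not> bad_step ?B K l k p i"
    then show "2 * ?m i \<le> ?m (Suc i)" by (rule step_growth[OF g fin W k])
  qed (auto simp: log_growth_nonneg)
  moreover have "2^k + real (2^l) * 2^(k - l) = 2^(Suc k)" using k by (simp flip: power_add)
  ultimately have 1: "2 ^ card ?G * log_growth g ?c (2^k) \<le> log_growth g ?c (2^(Suc k))" by simp
  have "card ?G + card ?I = card (?G \<union> ?I)" by (rule card_Un_disjoint[symmetric]) auto
  also have "?G \<union> ?I = {0..<2^l}" by auto
  finally have "card ?G + card ?I = 2^l" by simp
  moreover have "2 * card ?I \<le> 2^l" using good by (simp add: bad_level_def)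
  moreover have "(2::nat)^l = 2 * 2^(l - 1)" using l by (cases l) auto
  ultimately have "2^(l - 1) \<le> card ?G" by linarith
  then have "(2::real)^(2^(l - 1)) * log_growth g ?c (2^k) \<le> 2^card ?G * log_growth g ?c (2^k)"
    by (intro mult_right_mono power_increasing log_growth_nonneg) auto
  with 1 show ?thesis by linarith
qed

text \<open>
  For \<open>l \<ge> 2\<close> the growth over a good block is at least this fast: \<open>2^(l - 2)\<close> good levels, each with
  \<open>2^(l - 1)\<close> doublings, contribute \<open>2^(2 * l - 3)\<close> doublings.
\<close>

definition slow_at :: "(complex \<Rightarrow> complex) \<Rightarrow> complex \<Rightarrow> nat \<Rightarrow> bool" where
  "slow_at g c l \<longleftrightarrow>
     log_growth g c (2^(2^(l + 1))) < 2^(2^(2 * l - 3)) * log_growth g c (2^(2^l))"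

lemma twice_le_power: "2 \<le> l \<Longrightarrow> 2 * l \<le> 2^l"
  by (induction l rule: dec_induct) auto

lemma slow_imp_bad_block:
  assumes g: "g holomorphic_on UNIV" and fin: "finite W"
    and W: "lattice_floor ` cball (lattice_point p) (2^K) \<subseteq> W"
    and l: "2 \<le> l" "2^(l + 1) \<le> K"
    and slow: "slow_at g (lattice_point p) l"
  shows "bad_block (large_squares g \<inter> W) K p l"
proof (rule ccontr)
  assume good: "\<not> bad_block (large_squares g \<inter> W) K p l"
  let ?B = "large_squares g \<inter> W"
  let ?c = "lattice_point p"
  let ?m = "\<lambda>k. log_growth g ?c (2^k)"
  let ?L = "{2^l + l..<2^(l + 1)}"
  let ?G = "{k\<in>?L. \<not> bad_level ?B K l p k}"
  let ?I = "{k\<in>?L. bad_level ?B K l p k}"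
  let ?b = "2^(2^(l - 1)) :: real"
  have l2: "2 * l \<le> 2^l" by (rule twice_le_power[OF l(1)])
  have mono: "?m j \<le> ?m k" if "j \<le> k" for j k
    using that by (intro log_growth_mono[OF g]) (auto intro: power_increasing)
  have b1: "1 \<le> ?b" by simp
  have 1: "?b ^ card ?G * ?m (2^l + l) \<le> ?m (2^(l + 1))"
  proof (rule growth_iterate[OF _ b1])
    show "2^l + l \<le> 2^(l + 1)" using l2 by simp
    fix k show "?m k \<le> ?m (Suc k)" by (rule mono) simp
    assume k: "2^l + l \<le> k" "k < 2^(l + 1)" "\<not> bad_level ?B K l p k"
    show "?b * ?m k \<le> ?m (Suc k)"
      by (rule level_growth[OF g fin W _ _ _ k(3)]) (use k l l2 in auto)
  qed (rule log_growth_nonneg)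
  have "card ?G + card ?I = card (?G \<union> ?I)" by (rule card_Un_disjoint[symmetric]) auto
  also have "?G \<union> ?I = ?L" by auto
  finally have "card ?G + card ?I = 2^l - l" by simp
  moreover have "4 * card ?I \<le> 2^l" using good by (simp add: bad_block_def)
  moreover have "(2::nat)^l = 4 * 2^(l - 2)"
  proof -
    have "(2::nat)^l = 2^2 * 2^(l - 2)"
      using power_add[of "2::nat" 2 "l - 2"] by (simp only: le_add_diff_inverse[OF l(1)])
    then show ?thesis by simp
  qed
  ultimately have "2^(l - 2) \<le> card ?G" using l2 by linarith
  then have "?b ^ 2^(l - 2) * ?m (2^l) \<le> ?b ^ card ?G * ?m (2^l + l)"
    by (intro mult_mono power_increasing b1 mono log_growth_nonneg) auto
  also have "?b ^ 2^(l - 2) = 2^(2^(2 * l - 3))"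
    using l(1) by (simp flip: power_mult power_add)
  finally show False using 1 slow by (simp add: slow_at_def)
qed

text \<open>
  The window for the large squares is three times as wide as that for the origins, so that it
  contains every disc of radius \<open>2^K\<close> around one of the origins.
\<close>

lemma card_slow_origins:
  assumes g: "g holomorphic_on UNIV" and K: "2^(L + 1) \<le> K"
  shows "real (card {p\<in>{0..<2^K} \<times> {0..<2^K}. \<exists>l\<in>{2..L}. slow_at g (lattice_point p) l}) \<le>
    11531808 * real (card (large_squares g \<inter> {-(2^K)..2 * 2^K} \<times> {-(2^K)..2 * 2^K}))"
proof -
  let ?X = "{0..<2^K} \<times> {0..<2^K} :: (int \<times> int) set"
  let ?W = "{-(2^K)..2 * 2^K} \<times> {-(2^K)..2 * 2^K} :: (int \<times> int) set"
  let ?B = "large_squares g \<inter> ?W"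
  have "card {p\<in>?X. \<exists>l\<in>{2..L}. slow_at g (lattice_point p) l}
     \<le> card {p\<in>?X. near_marked ?B K p \<or> (\<exists>l\<le>L. bad_block ?B K p l)}"
  proof (intro card_mono subsetI)
    fix p assume "p \<in> {p\<in>?X. \<exists>l\<in>{2..L}. slow_at g (lattice_point p) l}"
    then obtain l where p: "p \<in> ?X" and l: "2 \<le> l" "l \<le> L" "slow_at g (lattice_point p) l" by auto
    have "(2::nat)^(l + 1) \<le> 2^(L + 1)" using l(2) by (intro power_increasing) auto
    then have "2^(l + 1) \<le> K" using K by (rule order_trans)
    moreover have "lattice_floor ` cball (lattice_point p) (2^K) \<subseteq> ?W"
    proof
      fix q assume "q \<in> lattice_floor ` cball (lattice_point p) (2^K)"
      then obtain x where x: "q = lattice_floor x" "cmod (x - lattice_point p) \<le> 2^K"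
        by (auto simp: dist_norm norm_minus_commute)
      then have "\<bar>Re x - real_of_int (fst p)\<bar> \<le> real_of_int (2^K)" "\<bar>Im x - real_of_int (snd p)\<bar> \<le> real_of_int (2^K)"
        using abs_Re_le_cmod[of "x - lattice_point p"] abs_Im_le_cmod[of "x - lattice_point p"]
        by (auto simp: lattice_point_def)
      then have "fst p - 2^K \<le> fst q" "fst q \<le> fst p + 2^K" "snd p - 2^K \<le> snd q" "snd q \<le> snd p + 2^K"
        unfolding x(1) lattice_floor_def fst_conv snd_conv by linarith+
      then show "q \<in> ?W" using p by (auto simp: mem_Times_iff)
    qed
    ultimately have "bad_block ?B K p l"
      using l by (intro slow_imp_bad_block[OF g]) auto
    then show "p \<in> {p\<in>?X. near_marked ?B K p \<or> (\<exists>l\<le>L. bad_block ?B K p l)}"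
      using p l by auto
  qed auto
  also have "real \<dots> \<le> 11531808 * real (card ?B)"
    by (intro card_bad_origins) auto
  finally show ?thesis by simp
qed

section \<open>Events in the space of entire functions\<close>

definition scaled :: "real \<Rightarrow> (complex \<Rightarrow> complex) \<Rightarrow> complex \<Rightarrow> complex" where
  "scaled C f = (\<lambda>z. f z / of_real C)"

lemma scaled_holomorphic: "f \<in> entire_functions \<Longrightarrow> C > 0 \<Longrightarrow> scaled C f holomorphic_on UNIV"
  by (auto simp: scaled_def entire_functions_def intro!: holomorphic_intros)

lemma open_evaluation: "openin entire_topology {f\<in>entire_functions. a < cmod (f z)}"
  unfolding openin_entire_topology entire_open_def
proof (intro conjI ballI)
  fix f assume f: "f \<in> {f\<in>entire_functions. a < cmod (f z)}"
  show "\<exists>K e. compact K \<and> e > 0 \<and> (\<forall>g\<in>entire_functions.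
      (\<forall>z\<in>K. dist (f z) (g z) < e) \<longrightarrow> g \<in> {f\<in>entire_functions. a < cmod (f z)})"
  proof (intro exI[of _ "{z}"] exI[of _ "cmod (f z) - a"] conjI ballI impI)
    fix g assume g: "g \<in> entire_functions" "\<forall>x\<in>{z}. dist (f x) (g x) < cmod (f z) - a"
    have "cmod (f z) - cmod (g z) \<le> cmod (f z - g z)" by (rule norm_triangle_ineq2)
    with g show "g \<in> {f\<in>entire_functions. a < cmod (f z)}" by (simp add: dist_norm)
  qed (use f in auto)
qed auto

lemma sets_exceed: "{f\<in>entire_functions. \<exists>z\<in>A. a < cmod (f z)} \<in> sets entire_borel"
proof -
  have "{f\<in>entire_functions. \<exists>z\<in>A. a < cmod (f z)} = (\<Union>z\<in>A. {f\<in>entire_functions. a < cmod (f z)})"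
    by auto
  also have "openin entire_topology \<dots>" by (intro openin_Union) (auto intro: open_evaluation)
  finally show ?thesis unfolding sets_entire_borel by (intro sigma_sets.Basic) simp
qed

lemma measurable_log_growth:
  assumes "C > 0" "r \<ge> 0"
  shows "(\<lambda>f. log_growth (scaled C f) 0 r) \<in> borel_measurable entire_borel"
proof -
  have "(\<lambda>f. SUP z\<in>cball 0 r. cmod (scaled C f z)) \<in> borel_measurable entire_borel"
    unfolding borel_measurable_iff_greater
  proof
    fix a
    have "(a < (SUP z\<in>cball 0 r. cmod (scaled C f z))) \<longleftrightarrow> (\<exists>z\<in>cball 0 r. a * C < cmod (f z))"
      if "f \<in> entire_functions" for f
    proof -
      have "bdd_above ((\<lambda>z. cmod (scaled C f z)) ` cball 0 r)"
        by (intro bdd_above_norm_cball scaled_holomorphic that assms)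
      then have "(a < (SUP z\<in>cball 0 r. cmod (scaled C f z))) \<longleftrightarrow> (\<exists>z\<in>cball 0 r. a < cmod (scaled C f z))"
        using assms by (intro less_cSUP_iff) auto
      then show ?thesis using assms by (simp add: scaled_def norm_divide pos_less_divide_eq)
    qed
    then have "{f\<in>space entire_borel. a < (SUP z\<in>cball 0 r. cmod (scaled C f z))}
        = {f\<in>entire_functions. \<exists>z\<in>cball 0 r. a * C < cmod (f z)}"
      by (auto simp: space_entire_borel)
    then show "{f\<in>space entire_borel. a < (SUP z\<in>cball 0 r. cmod (scaled C f z))} \<in> sets entire_borel"
      using sets_exceed by simp
  qed
  then show ?thesis unfolding log_growth_def by measurable
qed

lemma log_growth_translate: "log_growth (scaled C (translate c f)) 0 r = log_growth (scaled C f) c r"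
proof -
  have "cball c r = (\<lambda>z. z + c) ` cball 0 r"
    using cball_translation[of c 0 r] by (simp add: add.commute)
  then show ?thesis by (simp add: log_growth_def scaled_def translate_def image_image)
qed

lemma slow_at_translate: "slow_at (scaled C (translate c f)) 0 l \<longleftrightarrow> slow_at (scaled C f) c l"
  by (simp add: slow_at_def log_growth_translate)

lemma large_squares_translate:
  "(0, 0) \<in> large_squares (scaled C (translate (lattice_point p) f)) \<longleftrightarrow> p \<in> large_squares (scaled C f)"
proof -
  have fl: "lattice_floor (z + lattice_point p) = p \<longleftrightarrow> lattice_floor z = (0, 0)" for z
    by (cases p) (auto simp: lattice_floor_def lattice_point_def)
  have "(\<exists>z. lattice_floor z = (0, 0) \<and> 1 < cmod (scaled C f (z + lattice_point p)))
      \<longleftrightarrow> (\<exists>z. lattice_floor z = p \<and> 1 < cmod (scaled C f z))"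
    using fl by (metis diff_add_cancel)
  then show ?thesis by (simp add: large_squares_def scaled_def translate_def)
qed

definition slow_event :: "real \<Rightarrow> nat \<Rightarrow> (complex \<Rightarrow> complex) set" where
  "slow_event C L = {f\<in>entire_functions. \<exists>l\<in>{2..L}. slow_at (scaled C f) 0 l}"

definition large_event :: "real \<Rightarrow> (complex \<Rightarrow> complex) set" where
  "large_event C = {f\<in>entire_functions. (0, 0) \<in> large_squares (scaled C f)}"

lemma sets_slow_event:
  assumes "C > 0" shows "slow_event C L \<in> sets entire_borel"
proof -
  note [measurable] = measurable_log_growth[OF assms]
  have "{f\<in>space entire_borel. \<exists>l\<in>{2..L}. slow_at (scaled C f) 0 l} \<in> sets entire_borel"
    unfolding slow_at_def by measurable
  then show ?thesis by (simp add: slow_event_def space_entire_borel)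
qed

lemma large_event_eq:
  "C > 0 \<Longrightarrow> large_event C = {f\<in>entire_functions. \<exists>z\<in>{z. lattice_floor z = (0, 0)}. C < cmod (f z)}"
  by (auto simp: large_event_def large_squares_def scaled_def norm_divide)

lemma sets_large_event: "C > 0 \<Longrightarrow> large_event C \<in> sets entire_borel"
  by (simp only: large_event_eq sets_exceed)

section \<open>Averaging over origins\<close>

locale invariant_entire = prob_space \<mu> for \<mu> :: "(complex \<Rightarrow> complex) measure" +
  assumes sets_mu: "sets \<mu> = sets entire_borel"
    and invariant: "translation_invariant \<mu>"
begin

lemma space_mu: "space \<mu> = entire_functions"
  using sets_eq_imp_space_eq[OF sets_mu] by (simp add: space_entire_borel)

lemma translate_preimage:
  assumes "A \<in> sets entire_borel"
  shows "{f\<in>entire_functions. translate w f \<in> A} \<in> sets \<mu>"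
    and "measure \<mu> {f\<in>entire_functions. translate w f \<in> A} = measure \<mu> A"
proof -
  have meas: "translate w \<in> \<mu> \<rightarrow>\<^sub>M \<mu>"
    using measurable_translate measurable_cong_sets[OF sets_mu sets_mu] by blast
  have A: "A \<in> sets \<mu>" using assms by (simp add: sets_mu)
  have eq: "translate w -` A \<inter> space \<mu> = {f\<in>entire_functions. translate w f \<in> A}"
    by (auto simp: space_mu)
  show "{f\<in>entire_functions. translate w f \<in> A} \<in> sets \<mu>"
    using measurable_sets[OF meas A] by (simp add: eq)
  have "measure \<mu> A = measure (distr \<mu> \<mu> (translate w)) A"
    using invariant by (simp add: translation_invariant_def)
  also have "\<dots> = measure \<mu> (translate w -` A \<inter> space \<mu>)" by (rule measure_distr[OF meas A])
  finally show "measure \<mu> {f\<in>entire_functions. translate w f \<in> A} = measure \<mu> A" by (simp add: eq)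
qed

lemma integral_sum_indicator:
  assumes "\<And>p. S p \<in> sets \<mu>"
  shows "integrable \<mu> (\<lambda>f. \<Sum>p\<in>X. indicator (S p) f :: real)"
    and "(\<integral>f. (\<Sum>p\<in>X. indicator (S p) f) \<partial>\<mu>) = (\<Sum>p\<in>X. measure \<mu> (S p))"
proof -
  have int: "integrable \<mu> (indicator (S p) :: _ \<Rightarrow> real)" for p
    using assms by (intro integrable_real_indicator) (auto simp: emeasure_eq_measure)
  then show "integrable \<mu> (\<lambda>f. \<Sum>p\<in>X. indicator (S p) f :: real)"
    by (intro Bochner_Integration.integrable_sum)
  have "S p \<inter> space \<mu> = S p" for p using sets.sets_into_space[OF assms] by blast
  then show "(\<integral>f. (\<Sum>p\<in>X. indicator (S p) f) \<partial>\<mu>) = (\<Sum>p\<in>X. measure \<mu> (S p))"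
    using int by (simp add: Bochner_Integration.integral_sum)
qed

text \<open>
  The preceding count holds for every function \<open>f\<close>; its expectation turns cardinalities into
  probabilities because every origin has the law of the origin \<open>0\<close>. The constant is
  \<open>16 * 11531808\<close>, where \<open>16\<close> bounds the ratio of the areas of the two windows.
\<close>

lemma slow_event_bound:
  assumes C: "C > 0"
  shows "measure \<mu> (slow_event C L) \<le> 184508928 * measure \<mu> (large_event C)"
proof -
  define K :: nat where "K = 2^(L + 1)"
  let ?X = "{0..<2^K} \<times> {0..<2^K} :: (int \<times> int) set"
  let ?W = "{-(2^K)..2 * 2^K} \<times> {-(2^K)..2 * 2^K} :: (int \<times> int) set"
  let ?S = "\<lambda>p. {f\<in>entire_functions. translate (lattice_point p) f \<in> slow_event C L}"
  let ?Q = "\<lambda>p. {f\<in>entire_functions. translate (lattice_point p) f \<in> large_event C}"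
  note S = translate_preimage[OF sets_slow_event[OF C, of L]]
  note Q = translate_preimage[OF sets_large_event[OF C]]
  have cardX: "card ?X = 2^K * 2^K" by (simp add: card_cartesian_product nat_power_eq)
  have cardW: "card ?W \<le> 16 * (2^K * 2^K)"
  proof -
    have "card ?W = (3 * 2^K + 1) * (3 * 2^K + 1)"
      by (simp add: card_cartesian_product nat_add_distrib nat_mult_distrib nat_power_eq)
    also have "\<dots> \<le> (4 * 2^K) * (4 * 2^K)" by (intro mult_mono) auto
    finally show ?thesis by simp
  qed
  have pointwise: "(\<Sum>p\<in>?X. indicator (?S p) f) \<le> 11531808 * (\<Sum>p\<in>?W. indicator (?Q p) f :: real)"
    if f: "f \<in> space \<mu>" for f
  proof -
    have fe: "f \<in> entire_functions" using f by (simp add: space_mu)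
    have "(\<Sum>p\<in>?X. indicator (?S p) f) = real (card {p\<in>?X. \<exists>l\<in>{2..L}. slow_at (scaled C f) (lattice_point p) l})"
      using fe by (simp add: indicator_def slow_event_def slow_at_translate translate_entire sum.inter_filter[symmetric] Int_def)
    also have "\<dots> \<le> 11531808 * real (card (large_squares (scaled C f) \<inter> ?W))"
      by (rule card_slow_origins[OF scaled_holomorphic[OF fe C]]) (simp add: K_def)
    also have "real (card (large_squares (scaled C f) \<inter> ?W)) = (\<Sum>p\<in>?W. indicator (?Q p) f)"
      using fe by (simp add: indicator_def large_event_def large_squares_translate translate_entire sum.inter_filter[symmetric] Int_def conj_commute)
    finally show ?thesis .
  qed
  have "real (card ?X) * measure \<mu> (slow_event C L) = (\<Sum>p\<in>?X. measure \<mu> (?S p))"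
    using S(2) by simp
  also have "\<dots> = (\<integral>f. (\<Sum>p\<in>?X. indicator (?S p) f) \<partial>\<mu>)"
    by (rule integral_sum_indicator(2)[OF S(1), symmetric])
  also have "\<dots> \<le> (\<integral>f. 11531808 * (\<Sum>p\<in>?W. indicator (?Q p) f) \<partial>\<mu>)"
    by (rule integral_mono[OF integral_sum_indicator(1)[OF S(1)]
          integrable_mult_right[OF integral_sum_indicator(1)[OF Q(1)]] pointwise])
  also have "\<dots> = 11531808 * (\<Sum>p\<in>?W. measure \<mu> (?Q p))"
    by (simp only: integral_mult_right_zero integral_sum_indicator(2)[OF Q(1)])
  also have "\<dots> = 11531808 * (real (card ?W) * measure \<mu> (large_event C))"
    using Q(2) by simp
  also have "\<dots> \<le> 11531808 * (real (16 * (2^K * 2^K)) * measure \<mu> (large_event C))"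
    using cardW by (intro mult_left_mono mult_right_mono of_nat_mono) auto
  finally have "real (2^K * 2^K) * measure \<mu> (slow_event C L)
     \<le> real (2^K * 2^K) * (184508928 * measure \<mu> (large_event C))"
    by (simp only: cardX)
  then show ?thesis by (simp add: mult_le_cancel_left)
qed

lemma slow_event_Union_bound:
  assumes C: "C > 0"
  shows "measure \<mu> (\<Union>L. slow_event C L) \<le> 184508928 * measure \<mu> (large_event C)"
proof (rule LIMSEQ_le_const2)
  show "(\<lambda>L. measure \<mu> (slow_event C L)) \<longlonglongrightarrow> measure \<mu> (\<Union>L. slow_event C L)"
    using sets_slow_event[OF C]
    by (intro finite_Lim_measure_incseq) (auto simp: sets_mu incseq_def slow_event_def)
qed (use slow_event_bound[OF C] in auto)

text \<open>
  An entire function is bounded on the unit square.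
\<close>

lemma large_event_tendsto: "(\<lambda>n. measure \<mu> (large_event (real (Suc n)))) \<longlonglongrightarrow> 0"
proof -
  have "(\<Inter>n. large_event (real (Suc n))) = {}"
  proof (rule ccontr)
    assume "(\<Inter>n. large_event (real (Suc n))) \<noteq> {}"
    then obtain f where f: "\<And>n. f \<in> large_event (real (Suc n))" by auto
    then have "f holomorphic_on UNIV" by (simp add: large_event_def entire_functions_def)
    from bdd_above_norm_cball[OF this, of 0 2] obtain M where "\<forall>z\<in>cball 0 2. cmod (f z) \<le> M"
      by (auto simp: bdd_above_def)
    then have M: "cmod (f z) \<le> M" if "cmod z \<le> 2" for z
      using that by auto
    obtain n where "M \<le> real n" using real_arch_simple by blast
    then have n: "M \<le> real (Suc n)" by simp
    obtain z where z: "lattice_floor z = (0, 0)" "real (Suc n) < cmod (f z)"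
      using f[of n] by (auto simp: large_event_eq)
    have "lattice_floor 0 = (0, 0)" by (simp add: lattice_floor_def)
    then have "cmod (z - 0) < 2" using z(1) by (intro lattice_floor_eq_dist) simp
    then show False using M[of z] z(2) n by simp
  qed
  moreover have "(\<lambda>n. measure \<mu> (large_event (real (Suc n)))) \<longlonglongrightarrow> measure \<mu> (\<Inter>n. large_event (real (Suc n)))"
    using sets_large_event
    by (intro finite_Lim_measure_decseq) (auto simp: sets_mu decseq_def large_event_eq)
  ultimately show ?thesis by simp
qed

lemma AE_eventually_not_slow:
  "AE f in \<mu>. \<exists>n. \<forall>l\<ge>2. \<not> slow_at (scaled (real (Suc n)) f) 0 l"
proof -
  let ?A = "\<lambda>n. \<Union>L. slow_event (real (Suc n)) L"
  let ?N = "\<Inter>n. ?A n"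
  have A: "?A n \<in> sets \<mu>" for n using sets_slow_event[of "real (Suc n)"] by (auto simp: sets_mu)
  then have N: "?N \<in> sets \<mu>" by auto
  have "measure \<mu> ?N \<le> 0"
  proof (rule LIMSEQ_le_const)
    show "(\<lambda>n. 184508928 * measure \<mu> (large_event (real (Suc n)))) \<longlonglongrightarrow> 0"
      using tendsto_mult_left[OF large_event_tendsto, of 184508928] by simp
    have "measure \<mu> ?N \<le> 184508928 * measure \<mu> (large_event (real (Suc n)))" for n
    proof -
      have "measure \<mu> ?N \<le> measure \<mu> (?A n)" using A by (intro finite_measure_mono) auto
      also have "\<dots> \<le> 184508928 * measure \<mu> (large_event (real (Suc n)))"
        by (rule slow_event_Union_bound) simp
      finally show ?thesis .
    qed
    then show "\<exists>M. \<forall>n\<ge>M. measure \<mu> ?N \<le> 184508928 * measure \<mu> (large_event (real (Suc n)))" by blast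
  qed
  then have "?N \<in> null_sets \<mu>"
    using N by (auto simp: null_sets_def emeasure_eq_measure measure_le_0_iff)
  then have "AE f in \<mu>. f \<notin> ?N" by (rule AE_not_in)
  moreover have "AE f in \<mu>. f \<in> entire_functions" using AE_space[of \<mu>] by (simp add: space_mu)
  ultimately show ?thesis
  proof eventually_elim
    case (elim f)
    then obtain n where n: "f \<notin> ?A n" by auto
    have "\<not> slow_at (scaled (real (Suc n)) f) 0 l" if "2 \<le> l" for l
    proof
      assume "slow_at (scaled (real (Suc n)) f) 0 l"
      then have "f \<in> slow_event (real (Suc n)) l"
        unfolding slow_event_def using elim(2) that by (intro CollectI conjI bexI[of _ l]) auto
      with n show False by blast
    qed
    then show ?case by blast
  qed
qed

end

section \<open>The growth of almost every function\<close>

text \<open>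
  Once the growth exceeds \<open>1\<close>, which happens because a non-constant entire function is unbounded,
  every block of levels multiplies it by \<open>2^(2^(2 * l - 3))\<close>. For radii \<open>R\<close> between
  \<open>2^(2^(l + 1))\<close> and \<open>2^(2^(l + 2))\<close> the exponent \<open>2^(2 * l - 3)\<close> is comparable to \<open>(ln R)^2\<close>, with an absolute
  constant.
\<close>

lemma iterated_log_growth:
  assumes f: "f \<in> entire_functions" "f \<notin> constant_functions" and C: "1 \<le> C"
    and fast: "\<And>l. 2 \<le> l \<Longrightarrow> \<not> slow_at (scaled C f) 0 l"
  shows "Liminf at_top (\<lambda>R::real. ereal (ln (ln (max_modulus f R)) / (ln R)\<^sup>2)) > 0"
proof -
  have hol: "f holomorphic_on UNIV" using f(1) by (simp add: entire_functions_def)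
  have holg: "scaled C f holomorphic_on UNIV" using scaled_holomorphic[OF f(1)] C by simp
  have le_f: "cmod (scaled C f z) \<le> cmod (f z)" for z
    using C by (simp add: scaled_def norm_divide divide_le_eq mult_le_cancel_left1)
  let ?m = "log_growth (scaled C f) 0"
  have "\<exists>z. C * exp 1 < cmod (f z)"
  proof (rule ccontr)
    assume "\<nexists>z. C * exp 1 < cmod (f z)"
    then have "bounded (range f)" by (auto simp: bounded_iff not_less)
    from Liouville_theorem[OF hol this] obtain c where "\<And>z. f z = c" by (auto simp: constant_on_def)
    then have "f = (\<lambda>_. c)" by auto
    with f(2) show False by (auto simp: constant_functions_def)
  qed
  then obtain z where z: "C * exp 1 < cmod (f z)" by blast
  obtain n where n: "cmod z \<le> real n" using real_arch_simple by blast
  define l0 where "l0 = max 2 n"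
  have l0: "1 \<le> ?m (2^(2^l0))"
  proof -
    have "n \<le> 2^(2^l0)"
    proof -
      have "n \<le> l0" by (simp add: l0_def)
      also have "\<dots> \<le> 2^l0" by (rule less_imp_le[OF less_exp])
      also have "\<dots> \<le> 2^(2^l0)" by (rule less_imp_le[OF less_exp])
      finally show ?thesis .
    qed
    then have "real n \<le> 2^(2^l0)" unfolding of_nat_le_numeral_power_cancel_iff .
    from order_trans[OF n this] have "z \<in> cball 0 (2^(2^l0))" by simp
    then have "cmod (scaled C f z) \<le> exp (?m (2^(2^l0)))" by (rule norm_le_exp_log_growth[OF holg])
    moreover have "exp 1 < cmod (scaled C f z)"
      using z C by (simp add: scaled_def norm_divide pos_less_divide_eq mult.commute)
    ultimately have "exp 1 < exp (?m (2^(2^l0)))" by linarith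
    then show ?thesis by simp
  qed
  have "1 / 128 \<le> ln (ln (max_modulus f R)) / (ln R)\<^sup>2" if R: "2^(2^(l0 + 1)) < R" for R :: real
  proof -
    define N where "N = (LEAST n. R \<le> 2^(2^n))"
    have "\<exists>n. R \<le> 2^(2^n)"
    proof -
      obtain n where n: "R \<le> real n" using real_arch_simple by blast
      have "n \<le> 2^n" by (rule less_imp_le[OF less_exp])
      also have "\<dots> \<le> 2^(2^n)" by (rule less_imp_le[OF less_exp])
      finally have "real n \<le> 2^(2^n)" unfolding of_nat_le_numeral_power_cancel_iff .
      from order_trans[OF n this] show ?thesis by blast
    qed
    then have N: "R \<le> 2^(2^N)" unfolding N_def by (rule LeastI_ex)
    have N_gt: "l0 + 1 < N"
    proof (rule ccontr)
      assume "\<not> l0 + 1 < N"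
      then have "(2::real)^(2^N) \<le> 2^(2^(l0 + 1))" by (intro power_increasing) auto
      with N R show False by linarith
    qed
    define l where "l = N - 2"
    have l: "N = l + 2" "l0 \<le> l" "2 \<le> l" using N_gt by (auto simp: l_def l0_def)
    have R_gt: "2^(2^(l + 1)) < R"
      using not_less_Least[of "l + 1" "\<lambda>n. R \<le> 2^(2^n)"] l by (simp add: N_def[symmetric] not_le)
    let ?u = "2^(2^(2 * l - 3)) :: real" and ?M = "max_modulus f R"
    have "?m (2^(2^l0)) \<le> ?m (2^(2^l))"
      using l(2) by (intro log_growth_mono[OF holg]) (auto intro!: power_increasing)
    with l0 have "?u * 1 \<le> ?u * ?m (2^(2^l))" by (intro mult_left_mono) auto
    also have "\<dots> \<le> ?m (2^(2^(l + 1)))" using fast[OF l(3)] by (simp add: slow_at_def not_less)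
    also have "\<dots> \<le> ln (max 1 ?M)"
    proof (rule log_growth_le)
      fix x :: complex assume "x \<in> cball 0 (2^(2^(l + 1)))"
      then have "x \<in> ball 0 R" using R_gt by simp
      moreover have "bdd_above ((\<lambda>z. cmod (f z)) ` ball 0 R)"
        by (rule bdd_above_mono[OF bdd_above_norm_cball[OF hol, of 0 R]]) auto
      ultimately have "cmod (f x) \<le> ?M" unfolding max_modulus_def by (rule cSUP_upper)
      then show "cmod (scaled C f x) \<le> exp (ln (max 1 ?M))" using le_f[of x] by simp
    qed auto
    finally have u: "?u \<le> ln (max 1 ?M)" by simp
    have u1: "1 \<le> ?u" by simp
    have "1 < ?M"
    proof (rule ccontr)
      assume "\<not> 1 < ?M"
      then have "max 1 ?M = 1" by simp
      then show False using u u1 by simp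
    qed
    with u have "?u \<le> ln ?M" by (simp add: max_def)
    then have "ln ?u \<le> ln (ln ?M)" by (intro ln_mono) auto
    then have lnln: "2^(2 * l - 3) * ln 2 \<le> ln (ln ?M)" by (simp add: ln_realpow)
    have R_pos: "1 < R" using R_gt one_le_power[of "2::real" "2^(l + 1)"] by linarith
    have "ln R \<le> ln (2^(2^N))" using N R_pos by (intro ln_mono) auto
    then have "ln R \<le> 2^N * ln 2" by (simp add: ln_realpow)
    moreover have "0 < ln R" using R_pos by simp
    ultimately have "(ln R)\<^sup>2 \<le> (2^N * ln 2)\<^sup>2" by (intro power_mono) auto
    also have "\<dots> = 128 * 2^(2 * l - 3) * (ln 2)\<^sup>2"
    proof -
      have "((2::real)^N)\<^sup>2 = 2^(7 + (2 * l - 3))" using l by (simp flip: power_mult) (simp add: power_add mult.commute)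
      then show ?thesis by (simp add: power_mult_distrib power_add)
    qed
    also have "\<dots> \<le> 128 * 2^(2 * l - 3) * ln 2"
      using ln_2_less_1 ln_gt_zero[of "2::real"] by (intro mult_left_mono) (auto simp: power2_eq_square mult_le_cancel_left1)
    finally have "1 / 128 * (ln R)\<^sup>2 \<le> ln (ln ?M)" using lnln by simp
    then show ?thesis using \<open>0 < ln R\<close> by (subst pos_le_divide_eq) auto
  qed
  then have "ereal (1 / 128) \<le> ereal (ln (ln (max_modulus f R)) / (ln R)\<^sup>2)"
    if "2^(2^(l0 + 1)) < R" for R :: real
    using that unfolding ereal_less_eq by blast
  then have "\<forall>\<^sub>F R in at_top. ereal (1 / 128) \<le> ereal (ln (ln (max_modulus f R)) / (ln R)\<^sup>2)"
    using eventually_gt_at_top by (rule eventually_mono[rotated])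
  then have "ereal (1 / 128) \<le> Liminf at_top (\<lambda>R::real. ereal (ln (ln (max_modulus f R)) / (ln R)\<^sup>2))"
    by (rule Liminf_bounded)
  then show ?thesis by (rule less_le_trans[rotated]) simp
qed

theorem mainTheorem2:
  fixes \<mu> :: "(complex \<Rightarrow> complex) measure"
  assumes "prob_space \<mu>"
    and "sets \<mu> = sets entire_borel"
    and "translation_invariant \<mu>"
    and "emeasure \<mu> constant_functions = 0"
  shows "AE f in \<mu>. Liminf at_top (\<lambda>R::real. ereal (ln (ln (max_modulus f R)) / (ln R)\<^sup>2)) > 0"
proof -
  interpret prob_space \<mu> by fact
  interpret invariant_entire \<mu> by unfold_locales (use assms in auto)
  have "constant_functions \<in> null_sets \<mu>"
    using assms(2,4) constant_functions_sets by (auto simp: null_sets_def)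
  then have "AE f in \<mu>. f \<notin> constant_functions" by (rule AE_not_in)
  moreover have "AE f in \<mu>. f \<in> entire_functions" using AE_space[of \<mu>] by (simp add: space_mu)
  ultimately show ?thesis using AE_eventually_not_slow
  proof eventually_elim
    case (elim f)
    then obtain n where "\<And>l. 2 \<le> l \<Longrightarrow> \<not> slow_at (scaled (real (Suc n)) f) 0 l" by blast
    then show ?case by (intro iterated_log_growth[OF elim(2,1), of "real (Suc n)"]) auto
  qed
qed

end
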